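(* Let $K$ be a real biquadratic field, with quadratic subfields $K_1,K_2,K_3$. Then for at least two of the indices $j\in\{1,2,3\}$, the indecomposable elements in $\mathcal{O}_{K_j}^+$ remain indecomposable in $\mathcal{O}_K^+$ (that is, every indecomposable element of $\mathcal{O}_{K_j}^+$ is an indecomposable element of $\mathcal{O}_K^+$).
   Context: A real biquadratic field is a field $\mathbb{Q}(\sqrt{p},\sqrt{q})$ of degree $4$ over $\mathbb{Q}$ with $p,q$ positive integers; it has exactly three quadratic subfields. For a totally real number field $F$ with ring of integers $\mathcal{O}_F$, $\mathcal{O}_F^+$ denotes the set of elements of $\mathcal{O}_F$ that are positive under every embedding $F\hookrightarrow\mathbb{R}$ (totally positive). An element $\alpha\in\mathcal{O}_F^+$ is indecomposable (in $\mathcal{O}_F^+$) if it cannot be written as $\alpha=\beta+\gamma$ with $\beta,\gamma\in\mathcal{O}_F^+$. *)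

theory Defs
  imports
    Complex_Main
    "HOL-Algebra.Generated_Fields"
    "HOL-Algebra.Embedded_Algebras"
    "HOL-Algebra.Algebraic_Closure_Type"
begin

text \<open>
  Number fields are represented as subfields of the real numbers, that is, as sets of reals.
  Positivity in such a field never refers to the given inclusion only, but to all its real embeddings.
\<close>

abbreviation real_ring :: "real ring" where
  "real_ring \<equiv> ring_of_type_algebra"

definition real_biquadratic_field :: "real set \<Rightarrow> bool" where
  "real_biquadratic_field K \<longleftrightarrow>
     (\<exists>p q :: nat. p > 0 \<and> q > 0 \<and> K = generate_field real_ring {sqrt (real p), sqrt (real q)}) \<and>
     ring.dimension real_ring 4 \<rat> K"

definition quadratic_subfields :: "real set \<Rightarrow> real set set" where
  "quadratic_subfields K =
     {F. F \<subseteq> K \<and> subfield F real_ring \<and> ring.dimension real_ring 2 \<rat> F}"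

definition ring_of_integers :: "real set \<Rightarrow> real set" where
  "ring_of_integers F = {x \<in> F. algebraic_int x}"

text \<open>
  A unital ring homomorphism defined on a field is automatically injective.  Its values outside
  \<open>F\<close> are unconstrained.
\<close>

definition real_embeddings :: "real set \<Rightarrow> (real \<Rightarrow> real) set" where
  "real_embeddings F = ring_hom (real_ring \<lparr>carrier := F\<rparr>) real_ring"

definition totally_positive_integers :: "real set \<Rightarrow> real set" where
  "totally_positive_integers F =
     {x \<in> ring_of_integers F. \<forall>\<sigma> \<in> real_embeddings F. \<sigma> x > 0}"

definition indecomposable :: "real set \<Rightarrow> real \<Rightarrow> bool" where
  "indecomposable F \<alpha> \<longleftrightarrow>
     \<alpha> \<in> totally_positive_integers F \<and>
     \<not> (\<exists>\<beta> \<in> totally_positive_integers F. \<exists>\<gamma> \<in> totally_positive_integers F. \<alpha> = \<beta> + \<gamma>)"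

end

theory Submission
  imports Defs "Jordan_Normal_Form.Char_Poly" "HOL-Computational_Algebra.Squarefree"
begin

text \<open>
  Let \<open>p, q, r\<close> be the squarefree radicands of the three quadratic subfields, and let \<open>\<alpha>\<close> be
  indecomposable in \<open>F = \<rat>(\<surd>p)\<close>, of discriminant \<open>D\<close>. Then \<open>\<alpha>\<close> extends to an integral basis
  \<open>\<alpha>, \<eta>\<close> with \<open>\<eta> < 0 < \<eta>'\<close> and \<open>\<alpha> \<eta>' - \<alpha>' \<eta> = \<surd>D\<close>. The functional
  \<open>T x = x \<eta>' - x' \<eta>\<close> is positive on totally positive elements and takes values in
  \<open>\<surd>D \<int>\<close> on integers. If \<open>\<alpha> = \<beta> + \<gamma>\<close> in \<open>K\<close>, the traces of \<open>\<beta>\<close> and \<open>\<gamma>\<close> to \<open>F\<close> have sum \<open>2 \<alpha>\<close>,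
  so \<open>T\<close> is exactly \<open>\<surd>D\<close> on each of them. Consequently the integer \<open>\<beta> \<eta>'\<close> has \<open>\<surd>p\<close>-component
  \<open>\<surd>D/4\<close>, and the signs of its conjugates force the \<open>\<surd>q\<close>- and \<open>\<surd>r\<close>-components to be
  smaller in absolute value. Such integers cannot exist for two of the three radicands at once:
  all components of integers are multiples of \<open>\<surd>D/4\<close> for the respective discriminants, which
  reduces the claim to a parity argument.
\<close>

section \<open>Algebraic integers\<close>

text \<open>An eigenvalue of an integer matrix is a root of the characteristic polynomial, which is
  monic with integer coefficients. The index set is arbitrary so that pairs of exponents can serve
  as indices.\<close>

lemma algebraic_int_eigenvalueI:
  fixes x :: real and v :: "'i \<Rightarrow> real" and A :: "'i \<Rightarrow> 'i \<Rightarrow> int"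
  assumes fin: "finite I" and nz: "\<exists>i\<in>I. v i \<noteq> 0"
    and eq: "\<And>i. i \<in> I \<Longrightarrow> x * v i = (\<Sum>j\<in>I. of_int (A i j) * v j)"
  shows "algebraic_int x"
proof -
  define n where "n = card I"
  obtain h where h: "bij_betw h {0..<n} I"
    using ex_bij_betw_nat_finite[OF fin] unfolding n_def by blast
  define B where "B = mat n n (\<lambda>(i, j). A (h i) (h j))"
  define M where "M = map_mat real_of_int B"
  define w where "w = vec n (\<lambda>i. v (h i))"
  have M: "M \<in> carrier_mat n n" and B: "B \<in> carrier_mat n n" and w: "w \<in> carrier_vec n"
    by (simp_all add: M_def B_def w_def)
  have "M *\<^sub>v w = x \<cdot>\<^sub>v w"
  proof (rule eq_vecI)
    fix i assume "i < dim_vec (x \<cdot>\<^sub>v w)"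
    hence i: "i < n" by (simp add: w_def)
    hence hi: "h i \<in> I" using h by (auto simp: bij_betw_def)
    have "(M *\<^sub>v w) $ i = (\<Sum>j\<in>{0..<n}. of_int (A (h i) (h j)) * v (h j))"
      using i by (simp add: M_def B_def w_def scalar_prod_def)
    also have "\<dots> = (\<Sum>j\<in>I. of_int (A (h i) j) * v j)"
      by (rule sum.reindex_bij_betw[OF h])
    also have "\<dots> = (x \<cdot>\<^sub>v w) $ i" using eq[OF hi] i by (simp add: w_def)
    finally show "(M *\<^sub>v w) $ i = (x \<cdot>\<^sub>v w) $ i" .
  qed (simp add: M_def B_def w_def)
  moreover have "w \<noteq> 0\<^sub>v n"
  proof
    assume "w = 0\<^sub>v n"
    hence "v (h i) = 0" if "i < n" for i using that by (metis index_vec index_zero_vec(1) w_def)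
    moreover obtain i where "i \<in> I" "v i \<noteq> 0" using nz by blast
    ultimately show False using h by (auto simp: bij_betw_def)
  qed
  ultimately have "eigenvalue M x"
    using M w by (auto simp: eigenvalue_def eigenvector_def)
  hence root: "poly (char_poly M) x = 0" using eigenvalue_root_char_poly[OF M] by simp
  have "char_poly M = map_poly of_int (char_poly B)"
    unfolding M_def by (rule of_int_hom.char_poly_hom[OF B])
  moreover have "lead_coeff (char_poly B) = 1" using degree_monic_char_poly[OF B] by simp
  ultimately show ?thesis using root by (auto simp: algebraic_int_altdef_ipoly)
qed

text \<open>The monic relation expresses \<open>x ^ m\<close> by lower powers, and repeated
  multiplication by \<open>x\<close> reduces all higher ones. Positivity of \<open>m\<close> keeps
  the monomial \<open>1\<close> among the spanning powers.\<close>

lemma algebraic_int_power_reduce: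
  fixes x :: real
  assumes "algebraic_int x"
  shows "\<exists>m>0. \<forall>i. \<exists>c::nat \<Rightarrow> int. x ^ i = (\<Sum>l<m. of_int (c l) * x ^ l)"
proof -
  obtain p where p: "poly (map_poly of_int p) x = 0" "lead_coeff p = 1"
    using assms by (auto simp: algebraic_int_altdef_ipoly)
  define m where "m = degree p"
  have "poly (map_poly of_int p) x = (\<Sum>l\<le>m. of_int (coeff p l) * x ^ l)"
    by (simp add: poly_altdef degree_map_poly coeff_map_poly m_def)
  also have "\<dots> = (\<Sum>l<m. of_int (coeff p l) * x ^ l) + x ^ m"
    using p(2) by (simp add: lessThan_Suc_atMost[symmetric] m_def)
  finally have xm: "x ^ m = (\<Sum>l<m. of_int (- coeff p l) * x ^ l)"
    using p(1) by (simp add: sum_negf)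
  have m0: "m > 0"
  proof (rule ccontr)
    assume "\<not> m > 0"
    thus False using xm by simp
  qed
  have "\<exists>c::nat \<Rightarrow> int. x ^ i = (\<Sum>l<m. of_int (c l) * x ^ l)" for i
  proof (induction i)
    case 0
    have "x ^ 0 = (\<Sum>l<m. of_int (if l = 0 then 1 else 0) * x ^ l)"
      using m0 by (simp add: if_distrib[of real_of_int] if_distrib[of "\<lambda>t. t * _"] cong: if_cong)
    thus ?case by (rule exI[of _ "\<lambda>l. if l = 0 then 1 else 0"])
  next
    case (Suc i)
    then obtain c :: "nat \<Rightarrow> int" where c: "x ^ i = (\<Sum>l<m. of_int (c l) * x ^ l)" by blast
    obtain k where k: "m = Suc k" using m0 by (cases m) auto
    \<comment> \<open>Multiplication by \<open>x\<close> shifts the coefficients up by one; the top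
      one, \<open>c k\<close>, lands on \<open>x ^ m\<close> and is folded back with the monic
      relation.\<close>
    define d where "d l = (case l of 0 \<Rightarrow> 0 | Suc l' \<Rightarrow> c l') - c k * coeff p l" for l
    have "x ^ Suc i = (\<Sum>l<m. of_int (c l) * x ^ Suc l)"
      by (simp add: c sum_distrib_left mult_ac)
    also have "\<dots> = (\<Sum>l<k. of_int (c l) * x ^ Suc l) + of_int (c k) * x ^ m"
      by (simp add: k)
    also have "(\<Sum>l<k. of_int (c l) * x ^ Suc l)
        = (\<Sum>l<m. of_int (case l of 0 \<Rightarrow> 0 | Suc l' \<Rightarrow> c l') * x ^ l)"
      unfolding k by (subst sum.lessThan_Suc_shift) simp
    also have "of_int (c k) * x ^ m = (\<Sum>l<m. of_int (- c k * coeff p l) * x ^ l)"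
      by (subst xm) (simp add: sum_distrib_left mult_ac)
    finally have "x ^ Suc i = (\<Sum>l<m. of_int (d l) * x ^ l)"
      by (simp add: d_def sum.distrib[symmetric] algebra_simps sum_subtractf)
    thus ?case by blast
  qed
  thus ?thesis using m0 by blast
qed

lemma
  fixes x y :: real
  assumes "algebraic_int x" and "algebraic_int y"
  shows algebraic_int_add: "algebraic_int (x + y)" and algebraic_int_mult: "algebraic_int (x * y)"
proof -
  \<comment> \<open>Multiplication by \<open>x + y\<close> or \<open>x * y\<close> acts by an integer matrix on the finitely many monomials
    \<open>x ^ i * y ^ j\<close> that span the ring generated by \<open>x\<close> and \<open>y\<close>.\<close>
  obtain m where m0: "m > 0"
    and m: "\<And>i. \<exists>c::nat \<Rightarrow> int. x ^ i = (\<Sum>l<m. of_int (c l) * x ^ l)"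
    using algebraic_int_power_reduce[OF assms(1)] by blast
  obtain n where n0: "n > 0"
    and n: "\<And>i. \<exists>c::nat \<Rightarrow> int. y ^ i = (\<Sum>l<n. of_int (c l) * y ^ l)"
    using algebraic_int_power_reduce[OF assms(2)] by blast
  define I where "I = {..<m} \<times> {..<n}"
  define v where "v k = x ^ fst k * y ^ snd k" for k :: "nat \<times> nat"
  have fin: "finite I" by (simp add: I_def)
  have nz: "\<exists>k\<in>I. v k \<noteq> 0" by (rule bexI[of _ "(0, 0)"]) (auto simp: I_def v_def m0 n0)
  have mono: "\<exists>c::nat \<times> nat \<Rightarrow> int. x ^ i * y ^ j = (\<Sum>k\<in>I. of_int (c k) * v k)" for i j
  proof -
    obtain c d :: "nat \<Rightarrow> int" where "x ^ i = (\<Sum>l<m. of_int (c l) * x ^ l)"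
      and "y ^ j = (\<Sum>l<n. of_int (d l) * y ^ l)" using m[of i] n[of j] by blast
    hence "x ^ i * y ^ j = (\<Sum>k\<in>I. of_int (c (fst k) * d (snd k)) * v k)"
      by (simp add: I_def v_def sum_product sum.cartesian_product case_prod_beta mult_ac)
    thus ?thesis by (rule exI[of _ "\<lambda>k. c (fst k) * d (snd k)"])
  qed
  obtain c where c: "\<And>i j. x ^ i * y ^ j = (\<Sum>k\<in>I. of_int (c i j k :: int) * v k)"
    using mono by metis
  show "algebraic_int (x + y)"
  proof (rule algebraic_int_eigenvalueI[OF fin nz])
    fix k assume "k \<in> I"
    have "(x + y) * v k = x ^ Suc (fst k) * y ^ snd k + x ^ fst k * y ^ Suc (snd k)"
      by (simp add: v_def algebra_simps)
    thus "(x + y) * v k = (\<Sum>j\<in>I. of_int (c (Suc (fst k)) (snd k) j + c (fst k) (Suc (snd k)) j) * v j)"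
      by (simp only: c) (simp add: sum.distrib[symmetric] algebra_simps)
  qed
  show "algebraic_int (x * y)"
  proof (rule algebraic_int_eigenvalueI[OF fin nz])
    fix k assume "k \<in> I"
    have "(x * y) * v k = x ^ Suc (fst k) * y ^ Suc (snd k)" by (simp add: v_def algebra_simps)
    thus "(x * y) * v k = (\<Sum>j\<in>I. of_int (c (Suc (fst k)) (Suc (snd k)) j) * v j)"
      by (simp only: c)
  qed
qed

lemma algebraic_int_diff:
  fixes x y :: real
  assumes "algebraic_int x" and "algebraic_int y"
  shows "algebraic_int (x - y)"
  using algebraic_int_add[OF assms(1), of "- y"] assms(2) by simp

section \<open>Real fields and their embeddings\<close>

lemma real_ring_simps [simp]:
  "carrier real_ring = UNIV" "x \<otimes>\<^bsub>real_ring\<^esub> y = x * y" "\<one>\<^bsub>real_ring\<^esub> = 1"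
  "\<zero>\<^bsub>real_ring\<^esub> = 0" "x \<oplus>\<^bsub>real_ring\<^esub> y = x + y"
  by (simp_all add: ring_of_type_algebra_def)

lemma field_real_ring: "field real_ring"
  by (rule field_from_type_algebra)

lemma real_ring_a_inv [simp]: "\<ominus>\<^bsub>real_ring\<^esub> x = - x"
proof -
  interpret field real_ring by (rule field_real_ring)
  show ?thesis by (rule minus_equality) simp_all
qed

lemma real_ring_m_inv [simp]: "x \<noteq> 0 \<Longrightarrow> inv\<^bsub>real_ring\<^esub> x = inverse x"
proof -
  assume "x \<noteq> 0"
  interpret field real_ring by (rule field_real_ring)
  show ?thesis using \<open>x \<noteq> 0\<close> by (intro comm_inv_char) simp_all
qed

section \<open>Subfields of the reals and adjunction of one element\<close>

lemma subfield_realI: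
  assumes "1 \<in> F" "\<And>x. x \<in> F \<Longrightarrow> - x \<in> F"
    "\<And>x y. x \<in> F \<Longrightarrow> y \<in> F \<Longrightarrow> x + y \<in> F"
    "\<And>x y. x \<in> F \<Longrightarrow> y \<in> F \<Longrightarrow> x * y \<in> F"
    "\<And>x. x \<in> F \<Longrightarrow> x \<noteq> 0 \<Longrightarrow> inverse x \<in> F"
  shows "subfield F real_ring"
proof -
  interpret field real_ring by (rule field_real_ring)
  show ?thesis using assms by (intro subfieldI' subringI) auto
qed

lemma subfield_realD:
  assumes "subfield F real_ring"
  shows "0 \<in> F" "1 \<in> F" "x \<in> F \<Longrightarrow> - x \<in> F"
    "x \<in> F \<Longrightarrow> y \<in> F \<Longrightarrow> x + y \<in> F" "x \<in> F \<Longrightarrow> y \<in> F \<Longrightarrow> x - y \<in> F"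
    "x \<in> F \<Longrightarrow> y \<in> F \<Longrightarrow> x * y \<in> F" "x \<in> F \<Longrightarrow> inverse x \<in> F"
    "x \<in> F \<Longrightarrow> y \<in> F \<Longrightarrow> x / y \<in> F" "\<rat> \<subseteq> F"
proof -
  interpret field real_ring by (rule field_real_ring)
  note E = subringE[OF subfieldE(1)[OF assms]]
  show zero: "0 \<in> F" and one: "1 \<in> F" and neg: "x \<in> F \<Longrightarrow> - x \<in> F" for x using E by auto
  show add: "x \<in> F \<Longrightarrow> y \<in> F \<Longrightarrow> x + y \<in> F" and mult: "x \<in> F \<Longrightarrow> y \<in> F \<Longrightarrow> x * y \<in> F" for x y
    using E(6,7) by auto
  show "x \<in> F \<Longrightarrow> y \<in> F \<Longrightarrow> x - y \<in> F" using add[of x "- y"] neg by simp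
  show inv: "x \<in> F \<Longrightarrow> inverse x \<in> F" for x
    using subfield_m_inv(1)[OF assms, of x] zero by (cases "x = 0") auto
  show div: "x \<in> F \<Longrightarrow> y \<in> F \<Longrightarrow> x / y \<in> F" for x y
    using mult inv by (simp add: divide_inverse)
  have nat: "of_nat n \<in> F" for n by (induction n) (auto intro: add one zero)
  have "of_int k \<in> F" for k
    by (cases k rule: int_cases2) (auto intro: neg nat)
  thus "\<rat> \<subseteq> F" by (auto elim!: Rats_cases' intro!: div)
qed

lemma subfield_Rats: "subfield \<rat> real_ring"
  by (rule subfield_realI) auto

text \<open>In general this is only the \<open>F\<close>-span of \<open>1\<close> and
  \<open>s\<close>; it is the field generated by \<open>s\<close> over \<open>F\<close> once
  \<open>s * s\<close> lies in \<open>F\<close>. The dimension arguments use it as a span.\<close>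

definition adjoin :: "real set \<Rightarrow> real \<Rightarrow> real set" where
  "adjoin F s = {x + y * s |x y. x \<in> F \<and> y \<in> F}"

lemma adjoinI: "x \<in> F \<Longrightarrow> y \<in> F \<Longrightarrow> u = x + y * s \<Longrightarrow> u \<in> adjoin F s"
  by (auto simp: adjoin_def)

lemma adjoinE:
  assumes "u \<in> adjoin F s"
  obtains x y where "x \<in> F" "y \<in> F" "u = x + y * s"
  using assms by (auto simp: adjoin_def)

lemma subfield_adjoin:
  assumes F: "subfield F real_ring" and s: "s * s \<in> F"
  shows "subfield (adjoin F s) real_ring"
proof (rule subfield_realI)
  note D = subfield_realD[OF F]
  show "1 \<in> adjoin F s" by (rule adjoinI[of 1 _ 0]) (auto intro: D)
  fix u assume u: "u \<in> adjoin F s"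
  then obtain x y where xy: "x \<in> F" "y \<in> F" "u = x + y * s" by (rule adjoinE)
  show "- u \<in> adjoin F s" by (rule adjoinI[of "- x" _ "- y"]) (use xy in \<open>auto intro: D\<close>)
  {
    fix v assume "v \<in> adjoin F s"
    then obtain x' y' where xy': "x' \<in> F" "y' \<in> F" "v = x' + y' * s" by (rule adjoinE)
    show "u + v \<in> adjoin F s"
      by (rule adjoinI[of "x + x'" _ "y + y'"]) (use xy xy' in \<open>auto intro: D simp: algebra_simps\<close>)
    show "u * v \<in> adjoin F s"
      proof (rule adjoinI)
      show "x * x' + y * y' * (s * s) \<in> F" "x * y' + y * x' \<in> F" using xy xy' s by (auto intro!: D)
    qed (simp add: xy xy' algebra_simps)
  }
  show "inverse u \<in> adjoin F s" if "u \<noteq> 0"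
  \<comment> \<open>The inverse comes from the conjugate \<open>x - y * s\<close> and the norm
    \<open>e\<close>. Since \<open>s\<close> may lie in \<open>F\<close>, that conjugate can vanish,
    and then \<open>u = x + x\<close> is already in \<open>F\<close>.\<close>
  proof (cases "x = y * s")
    case True
    hence "inverse u = inverse (x + x)" using xy by simp
    moreover have "inverse (x + x) \<in> F" using xy by (intro D)
    ultimately have "inverse u \<in> F" by (simp only:)
    thus ?thesis using adjoinI[OF _ D(1), of "inverse u" "inverse u" s] by simp
  next
    case False
    define e where "e = x * x - y * y * (s * s)"
    have e: "e = u * (x - y * s)" "e \<in> F"
      using D(5)[OF D(6)[OF xy(1,1)] D(6)[OF D(6)[OF xy(2,2)] s]]
      unfolding e_def xy(3) by (simp_all only:) (simp add: algebra_simps)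
    have e0: "e \<noteq> 0" using that False by (simp add: e)
    have "inverse u = (x - y * s) / e" using e0 that False by (simp add: e field_simps)
    also have "\<dots> = x / e + (- y / e) * s" by (simp add: diff_divide_distrib)
    finally show ?thesis by (rule adjoinI[OF D(8)[OF xy(1) e(2)] D(8)[OF D(3)[OF xy(2)] e(2)]])
  qed
qed

lemma subset_adjoin:
  assumes "subfield F real_ring"
  shows "F \<subseteq> adjoin F s" "s \<in> adjoin F s"
proof -
  note D = subfield_realD[OF assms]
  show "F \<subseteq> adjoin F s" by (auto intro!: adjoinI[of _ _ 0] D)
  show "s \<in> adjoin F s" by (rule adjoinI[of 0 _ 1]) (auto intro!: D)
qed

section \<open>Real embeddings and their extension\<close>

lemma real_embeddings_iff:
  "\<sigma> \<in> real_embeddings F \<longleftrightarrow> \<sigma> 1 = 1 \<and>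
    (\<forall>x\<in>F. \<forall>y\<in>F. \<sigma> (x + y) = \<sigma> x + \<sigma> y \<and> \<sigma> (x * y) = \<sigma> x * \<sigma> y)"
  by (auto simp: real_embeddings_def Ring.ring_hom_def)

text \<open>Values outside the field are unconstrained, so restricting an embedding to a smaller
  field leaves the function unchanged. This is why total positivity passes from a subfield to a
  larger field.\<close>

lemma real_embeddings_mono: "E \<subseteq> F \<Longrightarrow> real_embeddings F \<subseteq> real_embeddings E"
  unfolding real_embeddings_iff subset_iff by blast

lemma real_embeddings_id: "(\<lambda>x. x) \<in> real_embeddings F"
  by (simp add: real_embeddings_iff)

lemma real_embeddingsD:
  assumes F: "subfield F real_ring" and \<sigma>: "\<sigma> \<in> real_embeddings F"
  shows "\<sigma> 1 = 1" "x \<in> F \<Longrightarrow> y \<in> F \<Longrightarrow> \<sigma> (x + y) = \<sigma> x + \<sigma> y"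
    "x \<in> F \<Longrightarrow> y \<in> F \<Longrightarrow> \<sigma> (x * y) = \<sigma> x * \<sigma> y" "\<sigma> 0 = 0" "x \<in> \<rat> \<Longrightarrow> \<sigma> x = x"
    "x \<in> F \<Longrightarrow> \<sigma> (- x) = - \<sigma> x" "x \<in> F \<Longrightarrow> y \<in> F \<Longrightarrow> \<sigma> (x - y) = \<sigma> x - \<sigma> y"
proof -
  note D = subfield_realD[OF F]
  show one: "\<sigma> 1 = 1" and add: "x \<in> F \<Longrightarrow> y \<in> F \<Longrightarrow> \<sigma> (x + y) = \<sigma> x + \<sigma> y"
    and mult: "x \<in> F \<Longrightarrow> y \<in> F \<Longrightarrow> \<sigma> (x * y) = \<sigma> x * \<sigma> y" for x y
    using \<sigma> by (auto simp: real_embeddings_iff)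
  show zero: "\<sigma> 0 = 0" using add[of 0 0] D(1) by simp
  show neg: "x \<in> F \<Longrightarrow> \<sigma> (- x) = - \<sigma> x" for x using add[of x "- x"] D(3)[of x] zero by simp
  show "x \<in> F \<Longrightarrow> y \<in> F \<Longrightarrow> \<sigma> (x - y) = \<sigma> x - \<sigma> y" using add[of x "- y"] neg D(3) by simp
  have rat: "\<rat> \<subseteq> F" by (rule D)
  have nat: "\<sigma> (of_nat n) = of_nat n" for n
  proof (induction n)
    case (Suc n)
    have "\<sigma> (of_nat n + 1) = \<sigma> (of_nat n) + \<sigma> 1" by (rule add) (use rat in auto)
    thus ?case using Suc one by (simp add: add.commute)
  qed (simp add: zero)
  have int: "\<sigma> (of_int k) = of_int k" for k
  proof (cases k rule: int_cases2)
    case (nonpos n)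
    have "real n \<in> F" using rat by auto
    thus ?thesis using neg[of "real n"] nat nonpos by simp
  qed (simp add: nat)
  show "\<sigma> x = x" if x: "x \<in> \<rat>" for x
  proof -
    obtain a b :: int where ab: "b > 0" "coprime a b" "x = of_int a / of_int b"
      using x by (rule Rats_cases')
    have "\<sigma> (x * of_int b) = \<sigma> x * \<sigma> (of_int b)" by (rule mult) (use x rat in auto)
    hence "\<sigma> x * of_int b = of_int a" using ab by (simp add: int)
    thus ?thesis using ab(1) unfolding ab(3) by (simp add: field_simps)
  qed
qed

text \<open>An embedding fixes the integer coefficients of a monic polynomial vanishing at
  \<open>x\<close>, so \<open>\<sigma> x\<close> is a root of the same polynomial.\<close>

lemma algebraic_int_embedding:
  assumes F: "subfield F real_ring" and \<sigma>: "\<sigma> \<in> real_embeddings F"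
    and x: "x \<in> F" "algebraic_int x"
  shows "algebraic_int (\<sigma> x)"
proof -
  note D = subfield_realD[OF F] and E = real_embeddingsD[OF F \<sigma>]
  obtain p where p: "lead_coeff p = 1" "\<forall>i. coeff p i \<in> \<int>" "poly p x = 0"
    using x(2) by (auto elim: algebraic_int.cases)
  have "(\<forall>i. coeff q i \<in> \<int>) \<Longrightarrow> poly q x \<in> F \<and> \<sigma> (poly q x) = poly q (\<sigma> x)" for q
  proof (induction q)
    case 0
    show ?case by (simp add: D E)
  next
    case (pCons a q)
    have a: "a \<in> \<int>" using pCons.prems[rule_format, of 0] by simp
    hence aF: "a \<in> F" and a': "\<sigma> a = a" using D(9) E(5) Ints_subset_Rats by auto
    have "coeff q i \<in> \<int>" for i using pCons.prems[rule_format, of "Suc i"] by simp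
    hence "poly q x \<in> F \<and> \<sigma> (poly q x) = poly q (\<sigma> x)" using pCons.IH by blast
    thus ?case using x(1) aF a' by (simp add: D E)
  qed
  hence "poly p (\<sigma> x) = 0" using p E(4) by metis
  thus ?thesis using p by (intro algebraic_int.intros)
qed

text \<open>As \<open>s\<close> is not in \<open>F\<close>, the representation
  \<open>x + y * s\<close> is unique, so \<open>s\<close> may be sent to any real square root
  \<open>t\<close> of \<open>\<sigma> (s * s)\<close>. Both signs of \<open>t\<close> are used
  later.\<close>

lemma extend_embedding:
  assumes F: "subfield F real_ring" and \<sigma>: "\<sigma> \<in> real_embeddings F"
    and s: "s \<notin> F" "s * s \<in> F" and t: "t * t = \<sigma> (s * s)"
  obtains \<tau> where "\<tau> \<in> real_embeddings (adjoin F s)"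
    "\<And>x y. x \<in> F \<Longrightarrow> y \<in> F \<Longrightarrow> \<tau> (x + y * s) = \<sigma> x + \<sigma> y * t"
proof -
  note D = subfield_realD[OF F] and E = real_embeddingsD[OF F \<sigma>]
  define P where "P u z \<longleftrightarrow> fst z \<in> F \<and> snd z \<in> F \<and> u = fst z + snd z * s" for u z
  \<comment> \<open>The coordinates of \<open>u\<close> are picked by choice; for \<open>u\<close>
    in \<open>adjoin F s\<close>, the fact \<open>uniq\<close> leaves only one pair to pick.\<close>
  define \<tau> where "\<tau> u = \<sigma> (fst (SOME z. P u z)) + \<sigma> (snd (SOME z. P u z)) * t" for u
  have uniq: "x = x' \<and> y = y'"
    if "x \<in> F" "y \<in> F" "x' \<in> F" "y' \<in> F" "x + y * s = x' + y' * s" for x y x' y'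
  proof -
    have y: "y = y'"
    proof (rule ccontr)
      assume "y \<noteq> y'"
      hence "s = (x' - x) / (y - y')" using that by (simp add: field_simps)
      moreover have "(x' - x) / (y - y') \<in> F" using that by (intro D)
      ultimately show False using s(1) by simp
    qed
    thus ?thesis using that by simp
  qed
  have \<tau>: "\<tau> (x + y * s) = \<sigma> x + \<sigma> y * t" if xy: "x \<in> F" "y \<in> F" for x y
  proof -
    have "P (x + y * s) (x, y)" using xy by (simp add: P_def)
    hence "P (x + y * s) (SOME z. P (x + y * s) z)" by (rule someI)
    hence "(SOME z. P (x + y * s) z) = (x, y)"
      using uniq[OF xy, of "fst (SOME z. P (x + y * s) z)" "snd (SOME z. P (x + y * s) z)"]
      by (simp add: P_def prod_eq_iff)
    thus ?thesis by (simp add: \<tau>_def)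
  qed
  have "\<tau> \<in> real_embeddings (adjoin F s)"
    unfolding real_embeddings_iff
  proof (intro conjI ballI)
    show "\<tau> 1 = 1" using \<tau>[of 1 0] D E by simp
    fix u v assume "u \<in> adjoin F s" "v \<in> adjoin F s"
    then obtain x y x' y' where xy: "x \<in> F" "y \<in> F" "x' \<in> F" "y' \<in> F"
      and uv: "u = x + y * s" "v = x' + y' * s" by (elim adjoinE)
    have uv': "u + v = (x + x') + (y + y') * s"
      "u * v = (x * x' + y * y' * (s * s)) + (x * y' + y * x') * s"
      by (simp_all add: uv algebra_simps)
    have tuv: "\<tau> u = \<sigma> x + \<sigma> y * t" "\<tau> v = \<sigma> x' + \<sigma> y' * t"
      unfolding uv by (rule \<tau>[OF xy(1,2)], rule \<tau>[OF xy(3,4)])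
    note p = D(6)[OF xy(1,3)] D(6)[OF D(6)[OF xy(2,4)] s(2)] D(6)[OF xy(1,4)] D(6)[OF xy(2,3)]
    have sums: "\<tau> (u + v) = \<sigma> (x + x') + \<sigma> (y + y') * t"
      unfolding uv' by (rule \<tau>[OF D(4)[OF xy(1,3)] D(4)[OF xy(2,4)]])
    show "\<tau> (u + v) = \<tau> u + \<tau> v"
      unfolding sums E(2)[OF xy(1,3)] E(2)[OF xy(2,4)] tuv
      by (simp add: algebra_simps)
    have prods: "\<tau> (u * v) = \<sigma> (x * x' + y * y' * (s * s)) + \<sigma> (x * y' + y * x') * t"
      unfolding uv' by (rule \<tau>[OF D(4)[OF p(1,2)] D(4)[OF p(3,4)]])
    show "\<tau> (u * v) = \<tau> u * \<tau> v"
      unfolding prods E(2)[OF p(1,2)] E(2)[OF p(3,4)] E(3)[OF D(6)[OF xy(2,4)] s(2)]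
        E(3)[OF xy(1,3)] E(3)[OF xy(2,4)] E(3)[OF xy(1,4)] E(3)[OF xy(2,3)]
        tuv t[symmetric]
      by (simp add: algebra_simps)
  qed
  thus ?thesis using \<tau> by (rule that)
qed

section \<open>Dimension over the rationals\<close>

lemma Span_Rats_1: "ring.Span real_ring \<rat> [1] = \<rat>"
  and Span_Rats_pair: "ring.Span real_ring \<rat> [s, 1] = adjoin \<rat> s"
proof -
  interpret field real_ring by (rule field_real_ring)
  show 1: "Span \<rat> [1] = \<rat>"
    by (auto simp: line_extension_mem_iff)
  have "u \<in> Span \<rat> [s, 1] \<longleftrightarrow> (\<exists>y\<in>\<rat>. \<exists>x\<in>\<rat>. u = y * s + x)" for u
    using 1 line_extension_mem_iff[of u \<rat> s \<rat>] by simp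
  thus "Span \<rat> [s, 1] = adjoin \<rat> s"
    by (simp only: set_eq_iff adjoin_def mem_Collect_eq) (metis add.commute)
qed

lemma independent_1: "ring.independent real_ring \<rat> [1]"
  and independent_pair: "s \<notin> \<rat> \<Longrightarrow> ring.independent real_ring \<rat> [s, 1]"
proof -
  interpret field real_ring by (rule field_real_ring)
  show 1: "independent \<rat> [1]" by (rule li_Cons) auto
  show "independent \<rat> [s, 1]" if "s \<notin> \<rat>"
    by (rule li_Cons) (use that 1 Span_Rats_1 in auto)
qed

lemma dimension_quadratic_le:
  assumes "ring.dimension real_ring n \<rat> F" and "F \<subseteq> adjoin \<rat> s"
  shows "n \<le> 2"
proof -
  interpret field real_ring by (rule field_real_ring)
  obtain Us where Us: "independent \<rat> Us" "length Us = n" "Span \<rat> Us = F" "set Us \<subseteq> carrier real_ring"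
    using exists_base[OF subfield_Rats assms(1)] by blast
  have sub: "set Us \<subseteq> F" using Span_base_incl[OF subfield_Rats Us(4)] Us(3) by simp
  show ?thesis
  \<comment> \<open>The length of a basis of \<open>F\<close> is compared with that of
    \<open>[s, 1]\<close>. For rational \<open>s\<close> this list is dependent, and the comparison
    is made with \<open>[1]\<close>.\<close>
  proof (cases "s \<in> \<rat>")
    case True
    hence "F \<subseteq> \<rat>" using assms(2) by (auto elim!: adjoinE dest!: subsetD)
    hence "set Us \<subseteq> Span \<rat> [1]" using sub Span_Rats_1 by blast
    from independent_length_le[OF subfield_Rats Us(1) independent_1 this] show ?thesis using Us by simp
  next
    case False
    have "set Us \<subseteq> Span \<rat> [s, 1]" using sub assms(2) Span_Rats_pair by blast
    from independent_length_le[OF subfield_Rats Us(1) independent_pair[OF False] this]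
    show ?thesis using Us by simp
  qed
qed

lemma dimension_two_irrational:
  assumes "ring.dimension real_ring 2 \<rat> F"
  obtains u where "u \<in> F" "u \<notin> \<rat>"
proof -
  interpret field real_ring by (rule field_real_ring)
  obtain Us where Us: "independent \<rat> Us" "length Us = 2" "Span \<rat> Us = F" "set Us \<subseteq> carrier real_ring"
    using exists_base[OF subfield_Rats assms(1)] by blast
  have sub: "set Us \<subseteq> F" using Span_base_incl[OF subfield_Rats Us(4)] Us(3) by simp
  have "\<not> F \<subseteq> \<rat>"
  proof
    assume "F \<subseteq> \<rat>"
    hence "set Us \<subseteq> Span \<rat> [1]" using sub Span_Rats_1 by blast
    from independent_length_le[OF subfield_Rats Us(1) independent_1 this] show False using Us by simp
  qed
  thus ?thesis using that by blast
qed

lemma dimension_two_eq_adjoin: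
  assumes F: "subfield F real_ring" and dim: "ring.dimension real_ring 2 \<rat> F"
    and u: "u \<in> F" "u \<notin> \<rat>"
  shows "F = adjoin \<rat> u"
proof -
  interpret field real_ring by (rule field_real_ring)
  have "set [u, 1] \<subseteq> F" using u subfield_realD[OF F] by simp
  from independent_length_eq_dimension[OF subfield_Rats dim independent_pair[OF u(2)] this]
  show ?thesis using Span_Rats_pair by simp
qed

section \<open>Real quadratic fields\<close>

lemma int_square_mod_4: "(x * x) mod 4 = (if even x then 0 else 1)" for x :: int
proof (cases "even x")
  case True
  then obtain y where "x = 2 * y" by blast
  thus ?thesis by simp
next
  case False
  then obtain y where "x = 2 * y + 1" by (rule oddE)
  hence "x * x = 4 * (y * y + y) + 1" by (simp add: algebra_simps)
  thus ?thesis using False by presburger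
qed

text \<open>The discriminant of \<open>\<rat>(\<surd>d)\<close> if \<open>d \<noteq> 1\<close> is squarefree.\<close>

definition disc :: "nat \<Rightarrow> nat" where
  "disc d = (if d mod 4 = 1 then d else 4 * d)"

lemma squarefree_mod_4_nonzero: "squarefree (d :: nat) \<Longrightarrow> d mod 4 \<noteq> 0"
  using squarefreeD[of d 2] by (auto simp: mod_eq_0_iff_dvd)

locale quadratic =
  fixes d :: nat
  assumes squarefree: "squarefree d" and not_1: "d \<noteq> 1"
begin

definition D :: real where "D = real (disc d)"
text \<open>Together with \<open>1\<close> this is an integral basis in every residue class of
  \<open>d\<close> modulo 4, unlike the usual generators \<open>sqrt d\<close> and
  \<open>(1 + sqrt d) / 2\<close>.\<close>

definition \<omega> :: real where "\<omega> = (D + sqrt D) / 2"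
definition \<omega>' :: real where "\<omega>' = (D - sqrt D) / 2"
definition F :: "real set" where "F = adjoin \<rat> (sqrt (real d))"

lemma d_pos: "d > 0"
  using squarefree by (metis neq0_conv not_squarefree_0)

lemma D_pos: "D > 0"
  using d_pos by (simp add: D_def disc_def)

lemma \<omega>_diff: "\<omega> - \<omega>' = sqrt D"
  by (simp add: \<omega>_def \<omega>'_def field_simps)

text \<open>A rational algebraic integer is an integer, and the only squarefree square is 1.\<close>

lemma sqrt_irrational: "sqrt (real d) \<notin> \<rat>"
proof
  assume "sqrt (real d) \<in> \<rat>"
  moreover have "algebraic_int (sqrt (real d))" by (intro algebraic_int_sqrt) simp
  ultimately have "sqrt (real d) \<in> \<int>" by (metis rational_algebraic_int_is_int)
  then obtain k where k: "sqrt (real d) = of_int k" by (auto elim: Ints_cases)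
  have "real_of_int (int d) = (sqrt (real d))\<^sup>2" by simp
  also have "\<dots> = of_int (k\<^sup>2)" unfolding k by simp
  finally have "int d = k\<^sup>2" by (simp only: of_int_eq_iff)
  hence d: "d = (nat \<bar>k\<bar>)\<^sup>2" by (metis nat_abs_int_diff nat_int nat_power_eq abs_ge_zero power2_abs)
  hence "nat \<bar>k\<bar> dvd 1" using squarefreeD[OF squarefree, of "nat \<bar>k\<bar>"] by simp
  thus False using d not_1 by simp
qed

lemma sqrt_D: "sqrt D = (if d mod 4 = 1 then sqrt (real d) else 2 * sqrt (real d))"
  by (simp add: D_def disc_def real_sqrt_mult)

lemma subfield_F: "subfield F real_ring"
  unfolding F_def by (rule subfield_adjoin[OF subfield_Rats]) simp

lemma \<omega>_in: "\<omega> \<in> F" "sqrt D \<in> F" "sqrt (real d) \<in> F"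
proof -
  note S = subfield_realD[OF subfield_F]
  show d: "sqrt (real d) \<in> F" unfolding F_def by (rule subset_adjoin[OF subfield_Rats])
  have rat: "real n \<in> F" for n using S(9) by auto
  have "2 * sqrt (real d) \<in> F" using S(6)[OF _ d, of 2] rat[of 2] by simp
  thus D: "sqrt D \<in> F" using d by (simp add: sqrt_D)
  have "D \<in> F" "2 \<in> F" using rat[of 2] rat by (simp_all add: D_def)
  thus "\<omega> \<in> F" unfolding \<omega>_def by (intro S D)
qed

lemma \<omega>_combination_in: "of_int j + of_int k * \<omega> \<in> F"
proof -
  note S = subfield_realD[OF subfield_F]
  have "real_of_int n \<in> F" for n using S(9) by auto
  thus ?thesis by (intro S \<omega>_in)
qed

lemma embedding_conj:
  obtains \<tau> where "\<tau> \<in> real_embeddings F"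
    "\<And>x y. x \<in> \<rat> \<Longrightarrow> y \<in> \<rat> \<Longrightarrow> \<tau> (x + y * sqrt (real d)) = x - y * sqrt (real d)"
proof -
  have sq: "sqrt (real d) * sqrt (real d) \<in> \<rat>" by simp
  have t: "- sqrt (real d) * - sqrt (real d) = sqrt (real d) * sqrt (real d)" by simp
  show ?thesis
  proof (rule extend_embedding[OF subfield_Rats real_embeddings_id sqrt_irrational sq t])
    fix \<tau> assume \<tau>: "\<tau> \<in> real_embeddings (adjoin \<rat> (sqrt (real d)))"
      "\<And>x y. x \<in> \<rat> \<Longrightarrow> y \<in> \<rat> \<Longrightarrow> \<tau> (x + y * sqrt (real d)) = x + y * - sqrt (real d)"
    show thesis
    proof (rule that)
      show "\<tau> \<in> real_embeddings F" using \<tau>(1) by (simp add: F_def)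
      fix x y :: real assume "x \<in> \<rat>" "y \<in> \<rat>"
      from \<tau>(2)[OF this] show "\<tau> (x + y * sqrt (real d)) = x - y * sqrt (real d)"
        by (simp only: mult_minus_right add_uminus_conv_diff)
    qed
  qed
qed

text \<open>The factor \<open>h\<close> is \<open>1 / 2\<close> or \<open>1\<close> according to
  \<open>d\<close> modulo 4; presenting it as some nonzero rational hides this case distinction from
  later computations.\<close>

lemma \<omega>_expand:
  obtains h where "h \<in> \<rat>" "h \<noteq> 0" "\<omega> = D / 2 + h * sqrt (real d)" "\<omega>' = D / 2 - h * sqrt (real d)"
proof -
  define h :: real where "h = (if d mod 4 = 1 then 1 / 2 else 1)"
  have h: "sqrt D = 2 * h * sqrt (real d)"
    unfolding sqrt_D h_def by (cases "d mod 4 = 1") simp_all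
  have "\<omega> = D / 2 + h * sqrt (real d)" "\<omega>' = D / 2 - h * sqrt (real d)"
    unfolding \<omega>_def \<omega>'_def h by (simp_all add: field_simps)
  thus ?thesis by (intro that[of h]) (simp_all add: h_def)
qed

text \<open>A relation with \<open>k \<noteq> 0\<close> would make \<open>sqrt (real d)\<close>
  rational. Relations for \<open>\<omega>\<close> and for its conjugate both occur later, hence the
  disjunction.\<close>

lemma \<omega>_independent:
  assumes "of_int j + of_int k * \<omega> = 0 \<or> of_int j + of_int k * \<omega>' = 0"
  shows "j = 0 \<and> k = 0"
proof -
  obtain h where h: "h \<in> \<rat>" "h \<noteq> 0" "\<omega> = D / 2 + h * sqrt (real d)" "\<omega>' = D / 2 - h * sqrt (real d)"
    by (rule \<omega>_expand)
  have k: "k = 0"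
  proof (rule ccontr)
    assume k: "k \<noteq> 0"
    define r where "r = (of_int j + of_int k * D / 2) / (of_int k * h)"
    have kh: "of_int k * h \<noteq> 0" using k h(2) by simp
    have "of_int j + of_int k * D / 2 = of_int k * h * r" using kh by (simp add: r_def)
    hence "of_int j + of_int k * \<omega> = (of_int k * h) * (r + sqrt (real d))"
      "of_int j + of_int k * \<omega>' = (of_int k * h) * (r - sqrt (real d))"
      unfolding h(3,4) by (simp_all add: algebra_simps)
    hence "r + sqrt (real d) = 0 \<or> r - sqrt (real d) = 0" using assms kh by auto
    hence "sqrt (real d) = - r \<or> sqrt (real d) = r" by linarith
    moreover have "r \<in> \<rat>" using h(1) unfolding r_def D_def by auto
    ultimately show False using sqrt_irrational by auto
  qed
  thus ?thesis using assms by simp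
qed

lemma conj_\<omega>:
  assumes "\<And>x y. x \<in> \<rat> \<Longrightarrow> y \<in> \<rat> \<Longrightarrow> \<tau> (x + y * sqrt (real d)) = x - y * sqrt (real d)"
  shows "\<tau> (of_int j + of_int k * \<omega>) = of_int j + of_int k * \<omega>'"
proof -
  obtain h where h: "h \<in> \<rat>" "h \<noteq> 0" "\<omega> = D / 2 + h * sqrt (real d)" "\<omega>' = D / 2 - h * sqrt (real d)"
    by (rule \<omega>_expand)
  define x y where "x = of_int j + of_int k * (D / 2)" and "y = of_int k * h"
  have "x \<in> \<rat>" "y \<in> \<rat>" using h(1) by (auto simp: x_def y_def D_def)
  hence "\<tau> (x + y * sqrt (real d)) = x - y * sqrt (real d)" by (rule assms)
  moreover have "of_int j + of_int k * \<omega> = x + y * sqrt (real d)"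
    "of_int j + of_int k * \<omega>' = x - y * sqrt (real d)"
    unfolding h(3,4) x_def y_def by (simp_all add: algebra_simps)
  ultimately show ?thesis by simp
qed

section \<open>Integers and total positivity in quadratic fields\<close>

lemma algebraic_int_\<omega>: "algebraic_int (of_int j + of_int k * \<omega>)"
proof -
  \<comment> \<open>A discriminant is 0 or 1 modulo 4, so the polynomial
    \<open>X^2 - D X + D (D - 1) / 4\<close> with root \<open>\<omega>\<close> has integer
    coefficients.\<close>
  have "int (disc d) * (int (disc d) - 1) mod 4 = 0"
  proof (cases "d mod 4 = 1")
    case True
    hence "int d mod 4 = 1" by presburger
    hence "4 dvd int d - 1" by presburger
    thus ?thesis using True by (simp add: disc_def mod_eq_0_iff_dvd)
  qed (simp add: disc_def)
  then obtain c where c: "int (disc d) * (int (disc d) - 1) = 4 * c" by (metis dvdE mod_eq_0_iff_dvd)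
  have "real_of_int (int (disc d) * (int (disc d) - 1)) = D * (D - 1)" by (simp add: D_def)
  hence c': "D * (D - 1) = 4 * of_int c" unfolding c by simp
  have sq: "sqrt D * sqrt D = D" using D_pos by simp
  have "4 * (\<omega> * \<omega> - D * \<omega>) = sqrt D * sqrt D - D * D"
    by (simp add: \<omega>_def field_simps)
  also have "\<dots> = - (D * (D - 1))" unfolding sq by (simp add: algebra_simps)
  finally have "\<omega> * \<omega> - D * \<omega> + of_int c = 0" unfolding c' by simp
  hence root: "poly [:of_int c, - D, 1:] \<omega> = 0" by (simp add: algebra_simps)
  have "algebraic_int \<omega>"
    by (rule algebraic_int.intros[OF _ _ root]) (auto simp: coeff_pCons D_def split: nat.splits)
  thus ?thesis by (intro algebraic_int_add algebraic_int_mult) simp_all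
qed

text \<open>Trace and norm are integers, which makes \<open>2 * u\<close> and \<open>2 * v\<close>
  integers; a congruence modulo 4 then settles their parities. The two components are returned
  separately because later arguments compare only one of them.\<close>

lemma algebraic_int_\<omega>_coeffs:
  assumes uv: "u \<in> \<rat>" "v \<in> \<rat>" and int: "algebraic_int (u + v * sqrt (real d))"
  obtains j k :: int where "u + v * sqrt (real d) = of_int j + of_int k * \<omega>"
    "u = of_int j + of_int k * D / 2" "v * sqrt (real d) = of_int k * sqrt D / 2"
proof -
  let ?x = "u + v * sqrt (real d)" and ?y = "u - v * sqrt (real d)"
  obtain \<tau> where \<tau>: "\<tau> \<in> real_embeddings F"
    "\<And>x y. x \<in> \<rat> \<Longrightarrow> y \<in> \<rat> \<Longrightarrow> \<tau> (x + y * sqrt (real d)) = x - y * sqrt (real d)"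
    using embedding_conj by blast
  have "?x \<in> F" unfolding F_def using uv by (auto intro: adjoinI)
  hence y: "algebraic_int ?y"
    using algebraic_int_embedding[OF subfield_F \<tau>(1) _ int] \<tau>(2)[OF uv] by simp
  have "algebraic_int (2 * u)" using algebraic_int_add[OF int y] by simp
  moreover have "2 * u \<in> \<rat>" using uv by simp
  ultimately have "2 * u \<in> \<int>" by (rule rational_algebraic_int_is_int)
  then obtain m where m: "2 * u = of_int m" by (rule Ints_cases)
  have xy: "?x * ?y = u * u - v * v * real d" by (simp add: algebra_simps)
  have "u * u - v * v * real d \<in> \<rat>" using uv by simp
  with algebraic_int_mult[OF int y] have "u * u - v * v * real d \<in> \<int>"
    unfolding xy by (rule rational_algebraic_int_is_int)
  then obtain n where n: "u * u - v * v * real d = of_int n" by (rule Ints_cases)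
  have "(2 * v) * (2 * v) * real d = (2 * u) * (2 * u) - 4 * (u * u - v * v * real d)"
    by (simp add: algebra_simps)
  hence N: "(2 * v) * (2 * v) * real d = of_int (m * m - 4 * n)" unfolding m n by simp
  \<comment> \<open>The square of the reduced denominator \<open>B\<close> divides \<open>d\<close>,
    so squarefreeness gives \<open>B = 1\<close>.\<close>
  have "2 * v \<in> \<int>"
  proof -
    have "2 * v \<in> \<rat>" using uv by simp
    then obtain A B :: int where B: "B > 0" and co: "coprime A B" and v: "2 * v = of_int A / of_int B"
      by (rule Rats_cases')
    have "of_int A * of_int A * real d = of_int (m * m - 4 * n) * (of_int B * of_int B :: real)"
      using N B unfolding v by (simp add: field_simps)
    hence "real_of_int (A * A * int d) = of_int ((m * m - 4 * n) * (B * B))"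
      by (simp only: of_int_mult of_int_of_nat_eq)
    hence "A * A * int d = (m * m - 4 * n) * (B * B)" by (simp only: of_int_eq_iff)
    hence "B * B dvd A * A * int d" by simp
    moreover have "coprime (B * B) (A * A)" using co by (simp add: coprime_commute)
    ultimately have "B * B dvd int d" by (simp add: coprime_dvd_mult_right_iff)
    moreover have "B * B = int ((nat B)\<^sup>2)" using B by (simp add: power2_eq_square)
    ultimately have "(nat B)\<^sup>2 dvd d" by (simp only: int_dvd_int_iff)
    hence "nat B dvd 1" using squarefreeD[OF squarefree] by blast
    hence "B = 1" using B by simp
    thus ?thesis using v by simp
  qed
  then obtain w where w: "2 * v = of_int w" by (rule Ints_cases)
  have "real_of_int (w * w * int d) = of_int (m * m - 4 * n)" using N unfolding w by simp
  hence "w * w * int d = m * m - 4 * n" by (simp only: of_int_eq_iff)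
  hence "m * m - w * w * int d = 4 * n" by simp
  hence md0: "(m * m - w * w * int d) mod 4 = 0" by simp
  \<comment> \<open>Squares are 0 or 1 modulo 4, so this congruence gives \<open>m\<close> and
    \<open>w\<close> equal parity if \<open>d mod 4 = 1\<close> and makes both even
    otherwise.\<close>
  have "((m * m) mod 4 - (w * w) mod 4 * (int d mod 4)) mod 4
      = ((m * m) mod 4 - ((w * w) mod 4 * (int d mod 4)) mod 4) mod 4"
    by (rule mod_diff_right_eq[symmetric])
  also have "\<dots> = (m * m - w * w * int d) mod 4" by (simp only: mod_mult_eq mod_diff_eq)
  finally have md: "((m * m) mod 4 - (w * w) mod 4 * (int d mod 4)) mod 4 = 0" using md0 by simp
  show ?thesis
  proof (cases "d mod 4 = 1")
    case True
    hence d1: "int d mod 4 = 1" by presburger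
    have "even m \<longleftrightarrow> even w" using md unfolding int_square_mod_4 d1 by (auto split: if_splits)
    moreover have "odd (int d)" using d1 by presburger
    ultimately have "even (m - w * int d)" by simp
    then obtain j where j: "m - w * int d = 2 * j" by blast
    have "of_int m - of_int w * real d = 2 * real_of_int j" using arg_cong[OF j, of real_of_int] by simp
    hence u: "u = of_int j + of_int w * D / 2" using m True by (simp add: D_def disc_def)
    have v: "v * sqrt (real d) = of_int w * sqrt D / 2" using w True by (simp add: sqrt_D)
    show ?thesis by (rule that[OF _ u v]) (simp add: u v \<omega>_def algebra_simps add_divide_distrib)
  next
    case False
    have "int d mod 4 \<noteq> 0" using squarefree_mod_4_nonzero[OF squarefree] by presburger
    moreover have "int d mod 4 \<noteq> 1" using False by presburger
    ultimately have "int d mod 4 = 2 \<or> int d mod 4 = 3" by presburger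
    hence "even m \<and> even w"
      using md unfolding int_square_mod_4 by (auto split: if_splits)
    then obtain a b where ab: "m = 2 * a" "w = 2 * b" by blast
    \<comment> \<open>Here \<open>D = 4 * d\<close>, so \<open>b * \<omega>\<close> contributes
      \<open>2 * b * d\<close> to the rational part, and the integer coefficient has to compensate
      for it.\<close>
    have u: "u = of_int (a - 2 * b * int d) + of_int b * D / 2" using m False ab by (simp add: D_def disc_def)
    have v: "v * sqrt (real d) = of_int b * sqrt D / 2" using w False ab by (simp add: sqrt_D)
    show ?thesis by (rule that[OF _ u v]) (simp add: u v \<omega>_def algebra_simps add_divide_distrib)
  qed
qed

lemma ring_of_integers_F: "ring_of_integers F = {of_int j + of_int k * \<omega> |j k. True}"
proof (intro equalityI subsetI)
  fix x assume "x \<in> ring_of_integers F"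
  then obtain u v where "u \<in> \<rat>" "v \<in> \<rat>" "algebraic_int (u + v * sqrt (real d))" "x = u + v * sqrt (real d)"
    by (auto simp: ring_of_integers_def F_def elim!: adjoinE)
  thus "x \<in> {of_int j + of_int k * \<omega> |j k. True}" using algebraic_int_\<omega>_coeffs by blast
qed (auto simp: ring_of_integers_def \<omega>_combination_in algebraic_int_\<omega>)

text \<open>An embedding sends \<open>sqrt D\<close> to a square root of \<open>D\<close>, so it
  acts on the field as the identity or as the conjugation, and both occur.\<close>

lemma totally_positive_iff:
  "of_int j + of_int k * \<omega> \<in> totally_positive_integers F \<longleftrightarrow>
     of_int j + of_int k * \<omega> > 0 \<and> of_int j + of_int k * \<omega>' > 0"
proof
  assume tp: "of_int j + of_int k * \<omega> \<in> totally_positive_integers F"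
  obtain \<tau> where \<tau>: "\<tau> \<in> real_embeddings F"
    "\<And>x y. x \<in> \<rat> \<Longrightarrow> y \<in> \<rat> \<Longrightarrow> \<tau> (x + y * sqrt (real d)) = x - y * sqrt (real d)"
    using embedding_conj by blast
  have "\<sigma> (of_int j + of_int k * \<omega>) > 0" if "\<sigma> \<in> real_embeddings F" for \<sigma>
    using tp that by (simp add: totally_positive_integers_def)
  from this[OF \<tau>(1)] this[OF real_embeddings_id]
  show "of_int j + of_int k * \<omega> > 0 \<and> of_int j + of_int k * \<omega>' > 0"
    using conj_\<omega>[OF \<tau>(2)] by simp
next
  assume pos: "of_int j + of_int k * \<omega> > 0 \<and> of_int j + of_int k * \<omega>' > 0"
  have "\<sigma> (of_int j + of_int k * \<omega>) > 0" if \<sigma>: "\<sigma> \<in> real_embeddings F" for \<sigma>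
  proof -
    note S = real_embeddingsD[OF subfield_F \<sigma>]
    have "\<sigma> (sqrt D) * \<sigma> (sqrt D) = \<sigma> (sqrt D * sqrt D)"
      by (rule S(3)[OF \<omega>_in(2) \<omega>_in(2), symmetric])
    also have "sqrt D * sqrt D = D" using D_pos by simp
    also have "\<sigma> D = D" by (rule S(5)) (simp add: D_def)
    finally have "(\<sigma> (sqrt D))\<^sup>2 = (sqrt D)\<^sup>2" using D_pos by (simp add: power2_eq_square)
    hence s: "\<sigma> (sqrt D) = sqrt D \<or> \<sigma> (sqrt D) = - sqrt D" by (simp add: power2_eq_iff)
    define x y where "x = of_int j + of_int k * (D / 2)" and "y = (of_int k / 2 :: real)"
    have rat: "x \<in> \<rat>" "y \<in> \<rat>" by (auto simp: D_def x_def y_def)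
    hence F: "x \<in> F" "y \<in> F" using subfield_realD(9)[OF subfield_F] by auto
    have "\<sigma> (x + y * sqrt D) = x + y * \<sigma> (sqrt D)"
      using S(2)[OF F(1) subfield_realD(6)[OF subfield_F F(2) \<omega>_in(2)]] S(3)[OF F(2) \<omega>_in(2)]
        S(5)[OF rat(1)] S(5)[OF rat(2)] by simp
    moreover have "of_int j + of_int k * \<omega> = x + y * sqrt D" "of_int j + of_int k * \<omega>' = x - y * sqrt D"
      by (simp_all add: x_def y_def \<omega>_def \<omega>'_def algebra_simps add_divide_distrib diff_divide_distrib)
    ultimately show ?thesis using s pos by auto
  qed
  moreover have "of_int j + of_int k * \<omega> \<in> ring_of_integers F" using ring_of_integers_F by blast
  ultimately show "of_int j + of_int k * \<omega> \<in> totally_positive_integers F"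
    by (simp add: totally_positive_integers_def)
qed

text \<open>
  A first basis element \<open>\<eta>\<close> can be shifted by multiples of \<open>\<alpha>\<close>, which moves the interval from
  \<open>\<eta> / \<alpha>\<close> to \<open>\<eta>' / \<alpha>'\<close> by integers. If no shift has \<open>0\<close> in its interior, some shift lies inside
  \<open>(0, 1)\<close>, and then \<open>\<alpha> = \<eta> + (\<alpha> - \<eta>)\<close> is a decomposition.
\<close>

lemma indecomposable_basis:
  assumes "indecomposable F \<alpha>"
  obtains a b m n :: int where "\<alpha> = of_int a + of_int b * \<omega>"
    "of_int m + of_int n * \<omega> < 0" "of_int m + of_int n * \<omega>' > 0" "b * m - a * n = 1"
proof -
  define qv where "qv a b = of_int a + of_int b * \<omega>" for a b :: int
  define qc where "qc a b = of_int a + of_int b * \<omega>'" for a b :: int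
  note q = qv_def qc_def
  have tp: "\<alpha> \<in> totally_positive_integers F"
    and indec: "\<And>\<beta> \<gamma>. \<beta> \<in> totally_positive_integers F \<Longrightarrow> \<gamma> \<in> totally_positive_integers F \<Longrightarrow> \<alpha> \<noteq> \<beta> + \<gamma>"
    using assms by (auto simp: indecomposable_def)
  have tpi: "qv j k \<in> totally_positive_integers F \<longleftrightarrow> qv j k > 0 \<and> qc j k > 0" for j k
    unfolding q by (rule totally_positive_iff)
  have "\<alpha> \<in> ring_of_integers F" using tp by (simp add: totally_positive_integers_def)
  then obtain a b where ab: "\<alpha> = qv a b" unfolding ring_of_integers_F q by blast
  have pos: "qv a b > 0" "qc a b > 0" using tp tpi ab by auto
  have qmult: "qv (g * j) (g * k) = of_int g * qv j k" "qc (g * j) (g * k) = of_int g * qc j k" for g j k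
    by (simp_all add: q algebra_simps)
  have qadd: "qv (j + j') (k + k') = qv j k + qv j' k'" "qc (j + j') (k + k') = qc j k + qc j' k'" for j k j' k'
    by (simp_all add: q algebra_simps)
  \<comment> \<open>A common factor \<open>g > 1\<close> would decompose \<open>\<alpha>\<close> as
    \<open>\<alpha> / g + (g - 1) * (\<alpha> / g)\<close>.\<close>
  have cop: "coprime a b"
  proof (rule ccontr)
    assume nc: "\<not> coprime a b"
    define g where "g = gcd a b"
    have "g \<noteq> 0" using pos by (auto simp: g_def q)
    moreover have "g \<noteq> 1" using nc by (simp add: g_def coprime_iff_gcd_eq_1)
    moreover have "g \<ge> 0" by (simp add: g_def)
    ultimately have g: "g > 1" by simp
    obtain a' b' where a': "a = g * a'" "b = g * b'" unfolding g_def by (meson gcd_dvd1 gcd_dvd2 dvdE)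
    have p: "qv a' b' > 0" "qc a' b' > 0"
      using pos g unfolding a' qmult by (simp_all add: zero_less_mult_iff)
    hence "qv a' b' \<in> totally_positive_integers F" using tpi by simp
    moreover have "qv ((g - 1) * a') ((g - 1) * b') \<in> totally_positive_integers F"
      unfolding tpi unfolding qmult using p g by simp
    moreover have "\<alpha> = qv a' b' + qv ((g - 1) * a') ((g - 1) * b')"
      unfolding ab a' qmult by (simp add: algebra_simps)
    ultimately show False using indec by blast
  qed
  obtain m0 n0 where mn: "b * m0 - a * n0 = 1"
  proof -
    obtain u v where "u * a + v * b = 1" using bezout_int[of a b] cop by auto
    thus ?thesis by (intro that[of v "- u"]) (simp add: algebra_simps)
  qed
  \<comment> \<open>Divided by \<open>qv a b * qc a b\<close>, this is the length of the interval
    between the two ratios; a coefficient determinant of 1 makes it positive.\<close>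
  have det: "qc x y * qv a b - qv x y * qc a b = of_int (b * x - a * y) * sqrt D" for x y
  proof -
    have "qc x y * qv a b - qv x y * qc a b = of_int (b * x - a * y) * (\<omega> - \<omega>')"
      by (simp add: q algebra_simps)
    thus ?thesis by (simp add: \<omega>_diff)
  qed
  define e e' where "e = qv m0 n0 / qv a b" and "e' = qc m0 n0 / qc a b"
  \<comment> \<open>Shifting by the floor brings the ratio of the element to \<open>\<alpha>\<close>
    into the half-open interval from 0 to 1.\<close>
  define s where "s = \<lfloor>e\<rfloor>"
  define m n where "m = m0 - s * a" and "n = n0 - s * b"
  have qm: "qv m n = qv m0 n0 - of_int s * qv a b" "qc m n = qc m0 n0 - of_int s * qc a b"
    by (simp_all add: q m_def n_def algebra_simps)
  have mn': "b * m - a * n = 1" using mn by (simp add: m_def n_def algebra_simps)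
  have lo: "qv m n \<ge> 0"
  proof -
    have "of_int s * qv a b \<le> e * qv a b" using pos by (intro mult_right_mono) (simp_all add: s_def)
    thus ?thesis using pos by (simp add: qm e_def)
  qed
  have hi: "qv m n < qv a b"
  proof -
    have "e * qv a b < (of_int s + 1) * qv a b" using pos by (intro mult_strict_right_mono) (simp_all add: s_def)
    thus ?thesis using pos by (simp add: qm e_def algebra_simps)
  qed
  have D0: "sqrt D > 0" using D_pos by simp
  have cm: "qc m n * qv a b - qv m n * qc a b = sqrt D" using det[of m n] mn' by simp
  have cpos: "qc m n > 0"
  proof -
    have "qv m n * qc a b \<ge> 0" using lo pos by simp
    hence "qc m n * qv a b > 0" using cm D0 by linarith
    thus ?thesis using pos by (simp add: zero_less_mult_iff)
  qed
  have lo': "qv m n > 0"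
  proof (rule ccontr)
    assume "\<not> qv m n > 0"
    hence z: "qv m n = 0" using lo by simp
    hence "m = 0 \<and> n = 0" by (intro \<omega>_independent) (simp add: q)
    thus False using mn' by simp
  qed
  show ?thesis
  \<comment> \<open>If the conjugate ratio exceeds 1, subtracting \<open>\<alpha>\<close> once more
    makes the element negative and keeps its conjugate positive. Otherwise the element and its
    difference from \<open>\<alpha>\<close> are both totally positive.\<close>
  proof (cases "qc m n > qc a b")
    case True
    have "qv (m - a) (n - b) = qv m n - qv a b" "qc (m - a) (n - b) = qc m n - qc a b"
      by (simp_all add: q algebra_simps)
    hence "qv (m - a) (n - b) < 0" "qc (m - a) (n - b) > 0" using hi True by simp_all
    moreover have "b * (m - a) - a * (n - b) = 1" using mn' by (simp add: algebra_simps)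
    ultimately show ?thesis using that ab unfolding q by blast
  next
    case False
    have eq: "qv (a - m) (b - n) = qv a b - qv m n" "qc (a - m) (b - n) = qc a b - qc m n"
      by (simp_all add: q algebra_simps)
    have "qc a b \<noteq> qc m n"
    proof
      assume z: "qc a b = qc m n"
      have "of_int (m - a) + of_int (n - b) * \<omega>' = 0" using z by (simp add: q algebra_simps)
      hence "m - a = 0 \<and> n - b = 0" using \<omega>_independent by blast
      thus False using mn' by simp
    qed
    hence "qc a b - qc m n > 0" using False by simp
    hence "qv (a - m) (b - n) \<in> totally_positive_integers F"
      unfolding tpi unfolding eq using hi by simp
    moreover have "qv m n \<in> totally_positive_integers F" using lo' cpos by (simp add: tpi)
    moreover have "\<alpha> = qv (a - m) (b - n) + qv m n" by (simp add: eq ab)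
    ultimately show ?thesis using indec by blast
  qed
qed

end

section \<open>Biquadratic fields\<close>

text \<open>
  With \<open>a = gcd p q\<close> the radicands are \<open>ab\<close>, \<open>ac\<close> and \<open>bc\<close>; in this form the three quadratic
  subfields play symmetric roles.
\<close>

locale biquadratic =
  fixes p q r a b c :: nat
  assumes p: "p = a * b" and q: "q = a * c" and r: "r = b * c"
    and sqf: "squarefree a" "squarefree b" "squarefree c"
    and cop: "coprime a b" "coprime a c" "coprime b c"
    and not_1: "p \<noteq> 1" "q \<noteq> 1" "r \<noteq> 1"

text \<open>Exchanging \<open>p\<close> and \<open>q\<close> exchanges \<open>b\<close> and
  \<open>c\<close>; exchanging \<open>q\<close> and \<open>r\<close>, as in the next lemma,
  exchanges \<open>a\<close> and \<open>b\<close>. These transpositions carry results from one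
  quadratic subfield to the others.\<close>

lemma biquadratic_swap12: "biquadratic p q r a b c \<Longrightarrow> biquadratic q p r a c b"
  by (auto simp: biquadratic_def coprime_commute)

lemma biquadratic_swap23: "biquadratic p q r a b c \<Longrightarrow> biquadratic p r q b a c"
  by (auto simp: biquadratic_def coprime_commute)

definition span4 :: "nat \<Rightarrow> nat \<Rightarrow> nat \<Rightarrow> real set" where
  "span4 p q r = {x0 + x1 * sqrt (real p) + x2 * sqrt (real q) + x3 * sqrt (real r) |x0 x1 x2 x3.
     x0 \<in> \<rat> \<and> x1 \<in> \<rat> \<and> x2 \<in> \<rat> \<and> x3 \<in> \<rat>}"

lemma span4I:
  "\<lbrakk>x0 \<in> \<rat>; x1 \<in> \<rat>; x2 \<in> \<rat>; x3 \<in> \<rat>;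
    u = x0 + x1 * sqrt (real p) + x2 * sqrt (real q) + x3 * sqrt (real r)\<rbrakk> \<Longrightarrow> u \<in> span4 p q r"
  by (auto simp: span4_def)

lemma span4E:
  assumes "u \<in> span4 p q r"
  obtains x0 x1 x2 x3 where "x0 \<in> \<rat>" "x1 \<in> \<rat>" "x2 \<in> \<rat>" "x3 \<in> \<rat>"
    "u = x0 + x1 * sqrt (real p) + x2 * sqrt (real q) + x3 * sqrt (real r)"
  using assms by (auto simp: span4_def)

lemma span4_swap12: "span4 p q r = span4 q p r"
proof -
  have "span4 p q r \<subseteq> span4 q p r" for p q r
  proof
    fix u assume "u \<in> span4 p q r"
    then obtain x0 x1 x2 x3 where "x0 \<in> \<rat>" "x1 \<in> \<rat>" "x2 \<in> \<rat>" "x3 \<in> \<rat>"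
      "u = x0 + x1 * sqrt (real p) + x2 * sqrt (real q) + x3 * sqrt (real r)"
      by (rule span4E)
    thus "u \<in> span4 q p r" by (intro span4I[of x0 x2 x1 x3]) simp_all
  qed
  thus ?thesis by blast
qed

lemma span4_swap23: "span4 p q r = span4 p r q"
proof -
  have "span4 p q r \<subseteq> span4 p r q" for p q r
  proof
    fix u assume "u \<in> span4 p q r"
    then obtain x0 x1 x2 x3 where "x0 \<in> \<rat>" "x1 \<in> \<rat>" "x2 \<in> \<rat>" "x3 \<in> \<rat>"
      "u = x0 + x1 * sqrt (real p) + x2 * sqrt (real q) + x3 * sqrt (real r)"
      by (rule span4E)
    thus "u \<in> span4 p r q" by (intro span4I[of x0 x1 x3 x2]) simp_all
  qed
  thus ?thesis by blast
qed

text \<open>Integers of this shape arise from indecomposables of \<open>\<rat>(\<surd>p)\<close> that decompose in \<open>K\<close>.\<close>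

definition dominant :: "nat \<Rightarrow> nat \<Rightarrow> nat \<Rightarrow> bool" where
  "dominant p q r \<longleftrightarrow> (\<exists>x0\<in>\<rat>. \<exists>x2\<in>\<rat>. \<exists>x3\<in>\<rat>.
     algebraic_int (x0 + sqrt (real (disc p)) / 4 + x2 * sqrt (real q) + x3 * sqrt (real r)) \<and>
     \<bar>x2 * sqrt (real q)\<bar> < sqrt (real (disc p)) / 4 \<and> \<bar>x3 * sqrt (real r)\<bar> < sqrt (real (disc p)) / 4)"

lemma dominant_commute: "dominant p q r \<longleftrightarrow> dominant p r q"
proof -
  have *: "dominant p r q" if dom: "dominant p q r" for p q r
  proof -
    obtain x0 x2 x3 where x: "x0 \<in> \<rat>" "x2 \<in> \<rat>" "x3 \<in> \<rat>"
      "algebraic_int (x0 + sqrt (real (disc p)) / 4 + x2 * sqrt (real q) + x3 * sqrt (real r))"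
      "\<bar>x2 * sqrt (real q)\<bar> < sqrt (real (disc p)) / 4" "\<bar>x3 * sqrt (real r)\<bar> < sqrt (real (disc p)) / 4"
      using dom unfolding dominant_def by blast
    have eq: "x0 + sqrt (real (disc p)) / 4 + x3 * sqrt (real r) + x2 * sqrt (real q)
        = x0 + sqrt (real (disc p)) / 4 + x2 * sqrt (real q) + x3 * sqrt (real r)" by simp
    show ?thesis unfolding dominant_def
      by (rule bexI[OF _ x(1)], rule bexI[OF _ x(3)], rule bexI[OF _ x(2)], subst eq, intro conjI x)
  qed
  show ?thesis by (rule iffI; erule *)
qed

section \<open>Embeddings, integers and subfields of a biquadratic field\<close>

context biquadratic
begin

lemma quadratics: "quadratic p" "quadratic q" "quadratic r"
proof -
  have "squarefree p" unfolding p by (rule squarefree_mult_coprime[OF cop(1) sqf(1,2)])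
  thus "quadratic p" using not_1(1) by (rule quadratic.intro)
  have "squarefree q" unfolding q by (rule squarefree_mult_coprime[OF cop(2) sqf(1,3)])
  thus "quadratic q" using not_1(2) by (rule quadratic.intro)
  have "squarefree r" unfolding r by (rule squarefree_mult_coprime[OF cop(3) sqf(2,3)])
  thus "quadratic r" using not_1(3) by (rule quadratic.intro)
qed

sublocale P: quadratic p by (rule quadratics)
sublocale Q: quadratic q by (rule quadratics)
sublocale R: quadratic r by (rule quadratics)

lemma sqrt_mult:
  "sqrt (real p) * sqrt (real q) = real a * sqrt (real r)"
  "sqrt (real p) * sqrt (real r) = real b * sqrt (real q)"
  "sqrt (real q) * sqrt (real r) = real c * sqrt (real p)"
proof -
  have *: "sqrt x * sqrt y * (sqrt x * sqrt z) = x * (sqrt y * sqrt z)" if "x \<ge> 0" for x y z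
  proof -
    have "sqrt x * sqrt y * (sqrt x * sqrt z) = (sqrt x * sqrt x) * (sqrt y * sqrt z)"
      by (simp only: ac_simps)
    also have "sqrt x * sqrt x = x" using that by simp
    finally show ?thesis .
  qed
  show "sqrt (real p) * sqrt (real q) = real a * sqrt (real r)"
    unfolding p q r of_nat_mult real_sqrt_mult by (rule *) simp
  have "sqrt (real p) * sqrt (real r) = sqrt b * sqrt a * (sqrt b * sqrt c)"
    unfolding p q r of_nat_mult real_sqrt_mult by (simp only: mult_ac)
  also have "\<dots> = b * (sqrt a * sqrt c)" by (rule *) simp
  finally show "sqrt (real p) * sqrt (real r) = real b * sqrt (real q)"
    unfolding p q r of_nat_mult real_sqrt_mult .
  have "sqrt (real q) * sqrt (real r) = sqrt c * sqrt a * (sqrt c * sqrt b)"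
    unfolding p q r of_nat_mult real_sqrt_mult by (simp only: mult_ac)
  also have "\<dots> = c * (sqrt a * sqrt b)" by (rule *) simp
  finally show "sqrt (real q) * sqrt (real r) = real c * sqrt (real p)"
    unfolding p q r of_nat_mult real_sqrt_mult .
qed

lemma a_pos: "a > 0"
  using sqf(1) by (metis neq0_conv not_squarefree_0)

text \<open>Because \<open>sqrt r = sqrt p * sqrt q / a\<close>, the span is a tower of two
  quadratic extensions, to which the results on \<open>adjoin\<close> apply.\<close>

lemma span4_eq_adjoin: "span4 p q r = adjoin P.F (sqrt (real q))"
proof (intro equalityI subsetI)
  fix u assume "u \<in> span4 p q r"
  then obtain x0 x1 x2 x3 where x: "x0 \<in> \<rat>" "x1 \<in> \<rat>" "x2 \<in> \<rat>" "x3 \<in> \<rat>"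
    "u = x0 + x1 * sqrt (real p) + x2 * sqrt (real q) + x3 * sqrt (real r)"
    by (rule span4E)
  have "u = (x0 + x1 * sqrt (real p)) + x2 * sqrt (real q) + (x3 / a) * (a * sqrt (real r))"
    using x(5) a_pos by simp
  also have "\<dots> = (x0 + x1 * sqrt (real p)) + (x2 + (x3 / a) * sqrt (real p)) * sqrt (real q)"
    unfolding sqrt_mult(1)[symmetric] by (simp add: algebra_simps)
  finally have u: "u = (x0 + x1 * sqrt (real p)) + (x2 + (x3 / a) * sqrt (real p)) * sqrt (real q)" .
  have "x3 / a \<in> \<rat>" using x(4) by simp
  hence "x2 + (x3 / a) * sqrt (real p) \<in> P.F"
    unfolding P.F_def by (rule adjoinI[OF x(3) _ refl])
  moreover have "x0 + x1 * sqrt (real p) \<in> P.F"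
    unfolding P.F_def by (rule adjoinI[OF x(1,2) refl])
  ultimately show "u \<in> adjoin P.F (sqrt (real q))" by (intro adjoinI[OF _ _ u])
next
  fix u assume "u \<in> adjoin P.F (sqrt (real q))"
  then obtain v w where vw: "v \<in> P.F" "w \<in> P.F" "u = v + w * sqrt (real q)" by (rule adjoinE)
  obtain v0 v1 where v: "v0 \<in> \<rat>" "v1 \<in> \<rat>" "v = v0 + v1 * sqrt (real p)"
    using vw(1) unfolding P.F_def by (rule adjoinE)
  obtain w0 w1 where w: "w0 \<in> \<rat>" "w1 \<in> \<rat>" "w = w0 + w1 * sqrt (real p)"
    using vw(2) unfolding P.F_def by (rule adjoinE)
  have "u = v0 + v1 * sqrt (real p) + w0 * sqrt (real q) + w1 * (sqrt (real p) * sqrt (real q))"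
    by (simp add: vw(3) v(3) w(3) algebra_simps)
  hence "u = v0 + v1 * sqrt (real p) + w0 * sqrt (real q) + (w1 * a) * sqrt (real r)"
    unfolding sqrt_mult(1) by (simp only: mult.assoc)
  moreover have "w1 * real a \<in> \<rat>" using w(2) by simp
  ultimately show "u \<in> span4 p q r" using span4I[OF v(1,2) w(1)] by blast
qed

lemma subfield_span4: "subfield (span4 p q r) real_ring"
  unfolding span4_eq_adjoin
  by (rule subfield_adjoin[OF P.subfield_F]) (use subfield_realD(9)[OF P.subfield_F] in auto)

text \<open>Squaring \<open>sqrt q = x + y * sqrt p\<close> makes \<open>sqrt p\<close> rational
  unless \<open>x * y = 0\<close>; the case \<open>y = 0\<close> makes \<open>sqrt q\<close>
  rational, and \<open>x = 0\<close> makes \<open>sqrt r\<close> rational.\<close>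

lemma sqrt_q_notin: "sqrt (real q) \<notin> P.F"
proof
  assume "sqrt (real q) \<in> P.F"
  then obtain x y where xy: "x \<in> \<rat>" "y \<in> \<rat>" "sqrt (real q) = x + y * sqrt (real p)"
    unfolding P.F_def by (rule adjoinE)
  have square: "(x + y * s) * (x + y * s) = x * x + y * y * (s * s) + 2 * x * y * s" for s
    by (simp add: algebra_simps)
  have "real q = sqrt (real q) * sqrt (real q)" by simp
  also have "\<dots> = x * x + y * y * (sqrt (real p) * sqrt (real p)) + 2 * x * y * sqrt (real p)"
    unfolding xy(3) by (rule square)
  finally have e: "real q = x * x + y * y * real p + 2 * x * y * sqrt (real p)" by simp
  show False
  proof (cases "x * y = 0")
    case False
    hence "sqrt (real p) = (real q - x * x - y * y * real p) / (2 * (x * y))" using e by (simp add: field_simps)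
    moreover have "\<dots> \<in> \<rat>" using xy by simp
    ultimately show False using P.sqrt_irrational by simp
  next
    case True
    show False
    proof (cases "y = 0")
      case True
      thus False using xy Q.sqrt_irrational by simp
    next
      case False
      hence "sqrt (real p) * sqrt (real q) = y * (sqrt (real p) * sqrt (real p))" using True xy by simp
      hence "real a * sqrt (real r) = y * real p" unfolding sqrt_mult by simp
      hence "sqrt (real r) = y * real p / real a" using a_pos by (simp add: field_simps)
      moreover have "\<dots> \<in> \<rat>" using xy by simp
      ultimately show False using R.sqrt_irrational by simp
    qed
  qed
qed

text \<open>The identity on \<open>\<rat>\<close> is extended twice, with independent signs for
  \<open>sqrt p\<close> and \<open>sqrt q\<close>; the sign of \<open>sqrt r\<close> is then forced
  to be their product.\<close>

lemma embedding:
  assumes e: "e1 = 1 \<or> e1 = -1" "e2 = 1 \<or> e2 = (-1 :: real)"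
  obtains \<sigma> where "\<sigma> \<in> real_embeddings (span4 p q r)"
    "\<And>x0 x1 x2 x3. \<lbrakk>x0 \<in> \<rat>; x1 \<in> \<rat>; x2 \<in> \<rat>; x3 \<in> \<rat>\<rbrakk> \<Longrightarrow>
      \<sigma> (x0 + x1 * sqrt (real p) + x2 * sqrt (real q) + x3 * sqrt (real r)) =
      x0 + e1 * (x1 * sqrt (real p)) + e2 * (x2 * sqrt (real q)) + e1 * e2 * (x3 * sqrt (real r))"
proof -
  have sq: "sqrt (real p) * sqrt (real p) \<in> \<rat>" by simp
  have e_sq: "(e1 * s) * (e1 * s) = s * s" "(e2 * s) * (e2 * s) = s * s" for s
    using e by auto
  note t = e_sq(1)[of "sqrt (real p)"]
  show ?thesis
  proof (rule extend_embedding[OF subfield_Rats real_embeddings_id P.sqrt_irrational sq t])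
    fix \<tau> assume \<tau>: "\<tau> \<in> real_embeddings (adjoin \<rat> (sqrt (real p)))"
      "\<And>x y. x \<in> \<rat> \<Longrightarrow> y \<in> \<rat> \<Longrightarrow> \<tau> (x + y * sqrt (real p)) = x + y * (e1 * sqrt (real p))"
    have \<tau>F: "\<tau> \<in> real_embeddings P.F" using \<tau>(1) by (simp add: P.F_def)
    have qF: "sqrt (real q) * sqrt (real q) \<in> P.F" using subfield_realD(9)[OF P.subfield_F] by auto
    have "\<tau> (real q) = real q" by (rule real_embeddingsD(5)[OF P.subfield_F \<tau>F]) simp
    hence t': "(e2 * sqrt (real q)) * (e2 * sqrt (real q)) = \<tau> (sqrt (real q) * sqrt (real q))"
      unfolding e_sq by simp
    show thesis
    proof (rule extend_embedding[OF P.subfield_F \<tau>F sqrt_q_notin qF t'])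
      fix \<sigma> assume \<sigma>: "\<sigma> \<in> real_embeddings (adjoin P.F (sqrt (real q)))"
        "\<And>x y. x \<in> P.F \<Longrightarrow> y \<in> P.F \<Longrightarrow> \<sigma> (x + y * sqrt (real q)) = \<tau> x + \<tau> y * (e2 * sqrt (real q))"
      show thesis
      proof (rule that)
        show "\<sigma> \<in> real_embeddings (span4 p q r)" using \<sigma>(1) by (simp add: span4_eq_adjoin)
        fix x0 x1 x2 x3 :: real assume x: "x0 \<in> \<rat>" "x1 \<in> \<rat>" "x2 \<in> \<rat>" "x3 \<in> \<rat>"
        have x3a: "x3 / a \<in> \<rat>" using x by simp
        have F: "x0 + x1 * sqrt (real p) \<in> P.F" "x2 + (x3 / a) * sqrt (real p) \<in> P.F"
          unfolding P.F_def by (rule adjoinI[OF x(1,2) refl], rule adjoinI[OF x(3) x3a refl])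
        have expand1: "x0 + x1 * s + x2 * t + x3 * (s * t / a) = (x0 + x1 * s) + (x2 + (x3 / a) * s) * t" for s t
          by (simp add: algebra_simps)
        have expand2: "(x0 + x1 * (e1 * s)) + (x2 + (x3 / a) * (e1 * s)) * (e2 * t)
          = x0 + e1 * (x1 * s) + e2 * (x2 * t) + e1 * e2 * (x3 * (s * t / a))" for s t
          by (simp add: algebra_simps)
        have r': "sqrt (real r) = sqrt (real p) * sqrt (real q) / a" unfolding sqrt_mult(1) using a_pos by simp
        have "x0 + x1 * sqrt (real p) + x2 * sqrt (real q) + x3 * sqrt (real r)
            = (x0 + x1 * sqrt (real p)) + (x2 + (x3 / a) * sqrt (real p)) * sqrt (real q)"
          unfolding r' by (rule expand1)
        also have "\<sigma> \<dots> = (x0 + x1 * (e1 * sqrt (real p))) + (x2 + (x3 / a) * (e1 * sqrt (real p))) * (e2 * sqrt (real q))"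
          unfolding \<sigma>(2)[OF F] \<tau>(2)[OF x(1,2)] \<tau>(2)[OF x(3) x3a] ..
        also have "\<dots> = x0 + e1 * (x1 * sqrt (real p)) + e2 * (x2 * sqrt (real q)) + e1 * e2 * (x3 * sqrt (real r))"
          unfolding r' by (rule expand2)
        finally show "\<sigma> (x0 + x1 * sqrt (real p) + x2 * sqrt (real q) + x3 * sqrt (real r)) =
          x0 + e1 * (x1 * sqrt (real p)) + e2 * (x2 * sqrt (real q)) + e1 * e2 * (x3 * sqrt (real r))" .
      qed
    qed
  qed
qed

lemma conjugates:
  assumes x: "x0 \<in> \<rat>" "x1 \<in> \<rat>" "x2 \<in> \<rat>" "x3 \<in> \<rat>"
  obtains \<sigma>1 \<sigma>2 \<sigma>3 where "{\<sigma>1, \<sigma>2, \<sigma>3} \<subseteq> real_embeddings (span4 p q r)"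
    "\<sigma>1 (x0 + x1 * sqrt (real p) + x2 * sqrt (real q) + x3 * sqrt (real r))
       = x0 + x1 * sqrt (real p) - x2 * sqrt (real q) - x3 * sqrt (real r)"
    "\<sigma>2 (x0 + x1 * sqrt (real p) + x2 * sqrt (real q) + x3 * sqrt (real r))
       = x0 - x1 * sqrt (real p) + x2 * sqrt (real q) - x3 * sqrt (real r)"
    "\<sigma>3 (x0 + x1 * sqrt (real p) + x2 * sqrt (real q) + x3 * sqrt (real r))
       = x0 - x1 * sqrt (real p) - x2 * sqrt (real q) + x3 * sqrt (real r)"
proof -
  let ?V = "real_embeddings (span4 p q r)"
  let ?x = "x0 + x1 * sqrt (real p) + x2 * sqrt (real q) + x3 * sqrt (real r)"
  have ex: "\<exists>\<sigma>\<in>?V. \<sigma> ?x = x0 + e1 * (x1 * sqrt (real p)) + e2 * (x2 * sqrt (real q)) + e1 * e2 * (x3 * sqrt (real r))"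
    if e: "e1 = 1 \<or> e1 = -1" "e2 = 1 \<or> e2 = -1" for e1 e2 :: real
  proof (rule embedding[OF e])
    fix \<sigma> assume \<sigma>: "\<sigma> \<in> ?V"
      "\<And>x0 x1 x2 x3. \<lbrakk>x0 \<in> \<rat>; x1 \<in> \<rat>; x2 \<in> \<rat>; x3 \<in> \<rat>\<rbrakk> \<Longrightarrow>
        \<sigma> (x0 + x1 * sqrt (real p) + x2 * sqrt (real q) + x3 * sqrt (real r)) =
        x0 + e1 * (x1 * sqrt (real p)) + e2 * (x2 * sqrt (real q)) + e1 * e2 * (x3 * sqrt (real r))"
    show ?thesis using \<sigma>(2)[OF x] by (intro bexI[of _ \<sigma>] \<sigma>(1))
  qed
  have "\<exists>\<sigma>\<in>?V. \<sigma> ?x = x0 + x1 * sqrt (real p) - x2 * sqrt (real q) - x3 * sqrt (real r)"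
    using ex[of 1 "-1"] by simp
  moreover have "\<exists>\<sigma>\<in>?V. \<sigma> ?x = x0 - x1 * sqrt (real p) + x2 * sqrt (real q) - x3 * sqrt (real r)"
    using ex[of "-1" 1] by simp
  moreover have "\<exists>\<sigma>\<in>?V. \<sigma> ?x = x0 - x1 * sqrt (real p) - x2 * sqrt (real q) + x3 * sqrt (real r)"
    using ex[of "-1" "-1"] by simp
  ultimately show ?thesis using that by blast
qed

lemma algebraic_int_conjugates:
  assumes x: "x0 \<in> \<rat>" "x1 \<in> \<rat>" "x2 \<in> \<rat>" "x3 \<in> \<rat>"
    and int: "algebraic_int (x0 + x1 * sqrt (real p) + x2 * sqrt (real q) + x3 * sqrt (real r))"
  shows "algebraic_int (x0 + x1 * sqrt (real p) - x2 * sqrt (real q) - x3 * sqrt (real r))"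
    "algebraic_int (x0 - x1 * sqrt (real p) + x2 * sqrt (real q) - x3 * sqrt (real r))"
    "algebraic_int (x0 - x1 * sqrt (real p) - x2 * sqrt (real q) + x3 * sqrt (real r))"
proof -
  let ?x = "x0 + x1 * sqrt (real p) + x2 * sqrt (real q) + x3 * sqrt (real r)"
  have "?x \<in> span4 p q r" by (rule span4I[OF x refl])
  hence *: "algebraic_int (\<sigma> ?x)" if "\<sigma> \<in> real_embeddings (span4 p q r)" for \<sigma>
    using algebraic_int_embedding[OF subfield_span4 that] int by blast
  obtain \<sigma>1 \<sigma>2 \<sigma>3 where \<sigma>: "{\<sigma>1, \<sigma>2, \<sigma>3} \<subseteq> real_embeddings (span4 p q r)"
    "\<sigma>1 ?x = x0 + x1 * sqrt (real p) - x2 * sqrt (real q) - x3 * sqrt (real r)"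
    "\<sigma>2 ?x = x0 - x1 * sqrt (real p) + x2 * sqrt (real q) - x3 * sqrt (real r)"
    "\<sigma>3 ?x = x0 - x1 * sqrt (real p) - x2 * sqrt (real q) + x3 * sqrt (real r)"
    by (rule conjugates[OF x])
  show "algebraic_int (x0 + x1 * sqrt (real p) - x2 * sqrt (real q) - x3 * sqrt (real r))"
    "algebraic_int (x0 - x1 * sqrt (real p) + x2 * sqrt (real q) - x3 * sqrt (real r))"
    "algebraic_int (x0 - x1 * sqrt (real p) - x2 * sqrt (real q) + x3 * sqrt (real r))"
    using *[of \<sigma>1] *[of \<sigma>2] *[of \<sigma>3] \<sigma> by simp_all
qed

text \<open>All four conjugates of zero vanish, and their signed sums isolate the four
  terms.\<close>

lemma independent:
  assumes x: "x0 \<in> \<rat>" "x1 \<in> \<rat>" "x2 \<in> \<rat>" "x3 \<in> \<rat>"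
    and z: "x0 + x1 * sqrt (real p) + x2 * sqrt (real q) + x3 * sqrt (real r) = 0"
  shows "x0 = 0" "x1 = 0" "x2 = 0" "x3 = 0"
proof -
  let ?x = "x0 + x1 * sqrt (real p) + x2 * sqrt (real q) + x3 * sqrt (real r)"
  obtain \<sigma>1 \<sigma>2 \<sigma>3 where \<sigma>: "{\<sigma>1, \<sigma>2, \<sigma>3} \<subseteq> real_embeddings (span4 p q r)"
    "\<sigma>1 ?x = x0 + x1 * sqrt (real p) - x2 * sqrt (real q) - x3 * sqrt (real r)"
    "\<sigma>2 ?x = x0 - x1 * sqrt (real p) + x2 * sqrt (real q) - x3 * sqrt (real r)"
    "\<sigma>3 ?x = x0 - x1 * sqrt (real p) - x2 * sqrt (real q) + x3 * sqrt (real r)"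
    by (rule conjugates[OF x])
  have "\<sigma> ?x = 0" if "\<sigma> \<in> real_embeddings (span4 p q r)" for \<sigma>
    unfolding z by (rule real_embeddingsD(4)[OF subfield_span4 that])
  hence "\<sigma>1 ?x = 0" "\<sigma>2 ?x = 0" "\<sigma>3 ?x = 0" using \<sigma>(1) by simp_all
  hence "x0 = 0" "x1 * sqrt (real p) = 0" "x2 * sqrt (real q) = 0" "x3 * sqrt (real r) = 0"
    using z unfolding \<sigma> by linarith+
  thus "x0 = 0" "x1 = 0" "x2 = 0" "x3 = 0" using P.d_pos Q.d_pos R.d_pos by simp_all
qed

text \<open>Adding the suitable conjugate gives the trace to a quadratic subfield, whose irrational
  part is a multiple of half the root of the discriminant. Halving once more produces the
  quarter.\<close>

lemma integer_components:
  assumes x: "x0 \<in> \<rat>" "x1 \<in> \<rat>" "x2 \<in> \<rat>" "x3 \<in> \<rat>"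
    and int: "algebraic_int (x0 + x1 * sqrt (real p) + x2 * sqrt (real q) + x3 * sqrt (real r))"
  shows "\<exists>k::int. x1 * sqrt (real p) = of_int k * (sqrt (real (disc p)) / 4)"
    "\<exists>k::int. x2 * sqrt (real q) = of_int k * (sqrt (real (disc q)) / 4)"
    "\<exists>k::int. x3 * sqrt (real r) = of_int k * (sqrt (real (disc r)) / 4)"
proof -
  note c = algebraic_int_conjugates[OF x int]
  have "algebraic_int (2 * x0 + (2 * x1) * sqrt (real p))"
    using algebraic_int_add[OF int c(1)] by (simp add: algebra_simps)
  then obtain k :: int where "2 * x1 * sqrt (real p) = of_int k * sqrt P.D / 2"
    by (rule P.algebraic_int_\<omega>_coeffs[rotated 2]) (use x in auto)
  thus "\<exists>k::int. x1 * sqrt (real p) = of_int k * (sqrt (real (disc p)) / 4)"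
    by (intro exI[of _ k]) (simp add: P.D_def)
  have "algebraic_int (2 * x0 + (2 * x2) * sqrt (real q))"
    using algebraic_int_add[OF int c(2)] by (simp add: algebra_simps)
  then obtain k :: int where "2 * x2 * sqrt (real q) = of_int k * sqrt Q.D / 2"
    by (rule Q.algebraic_int_\<omega>_coeffs[rotated 2]) (use x in auto)
  thus "\<exists>k::int. x2 * sqrt (real q) = of_int k * (sqrt (real (disc q)) / 4)"
    by (intro exI[of _ k]) (simp add: Q.D_def)
  have "algebraic_int (2 * x0 + (2 * x3) * sqrt (real r))"
    using algebraic_int_add[OF int c(3)] by (simp add: algebra_simps)
  then obtain k :: int where "2 * x3 * sqrt (real r) = of_int k * sqrt R.D / 2"
    by (rule R.algebraic_int_\<omega>_coeffs[rotated 2]) (use x in auto)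
  thus "\<exists>k::int. x3 * sqrt (real r) = of_int k * (sqrt (real (disc r)) / 4)"
    by (intro exI[of _ k]) (simp add: R.D_def)
qed

text \<open>
  The relative norms of the integer to the three quadratic subfields are integers; comparing their
  rational parts excludes \<open>p mod 4 = 1\<close>, and the irrational part of the norm to \<open>\<rat>(\<surd>q)\<close> gives the
  parity of \<open>b\<close>.
\<close>

lemma odd_component:
  fixes n :: int
  assumes x0: "x0 \<in> \<rat>"
    and int: "algebraic_int (x0 + sqrt (real (disc p)) / 4 + of_int n * (sqrt (real (disc r)) / 4))"
  shows "p mod 4 \<noteq> 1" and "q mod 4 \<noteq> 1 \<Longrightarrow> even b"
proof -
  let ?P = "sqrt (real p)" and ?Q = "sqrt (real q)" and ?R = "sqrt (real r)"
  \<comment> \<open>\<open>x1\<close> and \<open>x3\<close> are the coefficients of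
    \<open>sqrt p\<close> and \<open>sqrt r\<close> once the discriminants are written out.\<close>
  define x1 :: real where "x1 = (if p mod 4 = 1 then 1 / 4 else 1 / 2)"
  define x3 :: real where "x3 = (if r mod 4 = 1 then of_int n / 4 else of_int n / 2)"
  have rat: "x1 \<in> \<rat>" "x3 \<in> \<rat>" by (simp_all add: x1_def x3_def)
  have x1: "sqrt (real (disc p)) / 4 = x1 * ?P"
    using P.sqrt_D unfolding P.D_def x1_def by simp
  have x3: "of_int n * (sqrt (real (disc r)) / 4) = x3 * ?R"
    using R.sqrt_D unfolding R.D_def x3_def by simp
  let ?x = "x0 + x1 * ?P + x3 * ?R"
  have int': "algebraic_int ?x" using int unfolding x1 x3 .
  have "algebraic_int (x0 + x1 * ?P + 0 * ?Q + x3 * ?R)" using int' by simp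
  note c = algebraic_int_conjugates[OF x0 rat(1) Rats_0 rat(2) this]
  define A B C where "A = x0 * x0" and "B = x1 * x1 * real p" and "C = x3 * x3 * real r"
  have sq: "(u * sqrt (real d)) * (u * sqrt (real d)) = u * u * real d" for u d
    by (simp add: algebra_simps)
  have half: "2 * u \<in> \<int>" if u: "u \<in> \<rat>" "v \<in> \<rat>" "algebraic_int (u + v * sqrt (real d))"
    and d: "quadratic d" for u v d
  proof -
    interpret T: quadratic d by (rule d)
    obtain j k :: int where "u = of_int j + of_int k * T.D / 2"
      by (rule T.algebraic_int_\<omega>_coeffs[OF u])
    hence "2 * u = of_int (2 * j + k * int (disc d))" by (simp add: T.D_def)
    thus ?thesis by (simp only: Ints_of_int)
  qed
  \<comment> \<open>The products are the norms to the fields of \<open>sqrt p\<close> and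
    \<open>sqrt q\<close>; the terms \<open>0 * w\<close> match the vanishing
    \<open>sqrt q\<close>-component in the conjugates.\<close>
  have expand: "(x0 + s + t) * (x0 + s - 0 * w - t) = x0 * x0 + s * s - t * t + 2 * x0 * s"
    "(x0 + s + t) * (x0 - s + 0 * w - t) = x0 * x0 - s * s - t * t + - 2 * (s * t)" for s t w
    by (simp_all add: algebra_simps)
  have "algebraic_int (A + B - C + 2 * x0 * (x1 * ?P))"
    using algebraic_int_mult[OF int' c(1)] unfolding expand sq A_def B_def C_def .
  hence "algebraic_int (A + B - C + (2 * x0 * x1) * ?P)" by (simp only: mult.assoc)
  hence i1: "2 * (A + B - C) \<in> \<int>"
    by (rule half[rotated 2]) (use x0 rat quadratics in \<open>simp_all add: A_def B_def C_def\<close>)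
  have st: "- 2 * ((x1 * ?P) * (x3 * ?R)) = (- 2 * x1 * x3 * b) * ?Q"
  proof -
    have "(x1 * ?P) * (x3 * ?R) = x1 * x3 * (?P * ?R)" by (simp only: ac_simps)
    thus ?thesis unfolding sqrt_mult by simp
  qed
  have i2: "algebraic_int (A - B - C + (- 2 * x1 * x3 * b) * ?Q)"
    using algebraic_int_mult[OF int' c(2)] unfolding expand st sq A_def B_def C_def .
  hence i3: "2 * (A - B - C) \<in> \<int>"
    by (rule half[rotated 2]) (use x0 rat quadratics in \<open>simp_all add: A_def B_def C_def\<close>)
  \<comment> \<open>Subtracting the doubled rational parts isolates \<open>4 * B\<close>, which is
    \<open>p / 4\<close> if \<open>p mod 4 = 1\<close>.\<close>
  have "2 * (A + B - C) - 2 * (A - B - C) \<in> \<int>" by (rule Ints_diff[OF i1 i3])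
  hence i4: "4 * B \<in> \<int>" by simp
  show p1: "p mod 4 \<noteq> 1"
  proof
    assume p1: "p mod 4 = 1"
    hence "real p / 4 \<in> \<int>" using i4 by (simp add: B_def x1_def)
    then obtain k where "real p / 4 = of_int k" by (rule Ints_cases)
    hence "real_of_int (int p) = of_int (4 * k)" by simp
    hence "int p = 4 * k" by (simp only: of_int_eq_iff)
    thus False using p1 by presburger
  qed
  \<comment> \<open>For even \<open>n\<close>, subtracting \<open>n / 2\<close> times
    \<open>R.\<omega>\<close> would leave an integer of the first quadratic field with
    \<open>sqrt p\<close>-coefficient \<open>1 / 2\<close>, impossible as
    \<open>p mod 4 \<noteq> 1\<close>.\<close>
  have odd: "odd n"
  proof
    assume "even n"
    then obtain n' where n': "n = 2 * n'" by blast
    have expand3: "x0 + u + of_int (2 * n') * (z / 4) - (of_int 0 + of_int n' * ((d + z) / 2))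
        = (x0 - of_int n' * d / 2) + u" for u z d
      by (simp add: distrib_left add_divide_distrib)
    have "algebraic_int (x0 + x1 * ?P + of_int n * (sqrt (real (disc r)) / 4) - (of_int 0 + of_int n' * R.\<omega>))"
      using int' unfolding x3[symmetric] by (intro algebraic_int_diff R.algebraic_int_\<omega>)
    also have "x0 + x1 * ?P + of_int n * (sqrt (real (disc r)) / 4) - (of_int 0 + of_int n' * R.\<omega>)
       = (x0 - of_int n' * R.D / 2) + x1 * ?P"
      unfolding n' R.\<omega>_def R.D_def by (rule expand3)
    finally have "algebraic_int ((x0 - of_int n' * R.D / 2) + x1 * ?P)" .
    then obtain k :: int where "x1 * ?P = of_int k * sqrt P.D / 2"
      by (rule P.algebraic_int_\<omega>_coeffs[rotated 2]) (use x0 rat in \<open>auto simp: R.D_def\<close>)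
    hence "1 / 2 * ?P = of_int k * ?P" using p1 by (simp add: x1_def P.sqrt_D)
    hence "(1 / 2 :: real) = of_int k" using P.d_pos by simp
    hence "real_of_int 1 = of_int (2 * k)" by simp
    hence "1 = 2 * k" by (simp only: of_int_eq_iff)
    thus False by presburger
  qed
  show "even b" if q1: "q mod 4 \<noteq> 1"
  proof -
    \<comment> \<open>This is the irrational part of the norm to the field of \<open>sqrt q\<close>.
      As \<open>q mod 4 \<noteq> 1\<close> and \<open>x1 = 1 / 2\<close>, it makes
      \<open>x3 * b\<close> an integer, so \<open>n * b\<close> is even.\<close>
    obtain k :: int where k: "(- 2 * x1 * x3 * b) * ?Q = of_int k * sqrt Q.D / 2"
    proof (rule Q.algebraic_int_\<omega>_coeffs[OF _ _ i2])
      show "A - B - C \<in> \<rat>" "- 2 * x1 * x3 * b \<in> \<rat>"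
        using x0 rat by (simp_all add: A_def B_def C_def)
    qed (use that in blast)
    have "(- 2 * x1 * x3 * b) * ?Q = of_int k * ?Q" using k q1 by (simp add: Q.sqrt_D)
    moreover have "?Q \<noteq> 0" using Q.d_pos by simp
    ultimately have "- 2 * x1 * x3 * b = of_int k" using mult_right_cancel by blast
    hence "(4 * x3) * b = - 4 * of_int k" using p1 by (simp add: x1_def)
    moreover have "4 * x3 = of_int n \<or> 4 * x3 = 2 * of_int n" by (simp add: x3_def)
    ultimately have "of_int n * real b = - 4 * of_int k \<or> 2 * of_int n * real b = - 4 * of_int k"
      by metis
    hence "real_of_int (n * int b) = of_int (- 4 * k) \<or> real_of_int (n * int b) = of_int (- 2 * k)"
      by auto
    hence "n * int b = - 4 * k \<or> n * int b = - 2 * k" by (simp only: of_int_eq_iff)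
    hence "even (n * int b)" by (elim disjE) simp_all
    thus "even b" using odd by simp
  qed
qed

text \<open>
  As \<open>disc p \<le> disc q\<close>, the first integer has no \<open>\<surd>q\<close>-component. Subtracting a multiple of it from the
  second integer removes the \<open>\<surd>p\<close>-component there, so that both have the shape of the previous
  lemma, and \<open>b\<close> and \<open>c\<close> would both be even.
\<close>

lemma not_both_dominant_aux:
  assumes dp: "dominant p q r" and dq: "dominant q p r" and le: "disc p \<le> disc q"
  shows False
proof -
  let ?P = "sqrt (real p)" and ?Q = "sqrt (real q)" and ?R = "sqrt (real r)"
  let ?p = "sqrt (real (disc p)) / 4" and ?q = "sqrt (real (disc q)) / 4" and ?r = "sqrt (real (disc r)) / 4"
  define h1 :: real where "h1 = (if p mod 4 = 1 then 1 / 4 else 1 / 2)"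
  have h1: "?p = h1 * ?P" "h1 \<in> \<rat>" using P.sqrt_D unfolding P.D_def h1_def by simp_all
  define h2 :: real where "h2 = (if q mod 4 = 1 then 1 / 4 else 1 / 2)"
  have h2: "?q = h2 * ?Q" "h2 \<in> \<rat>" using Q.sqrt_D unfolding Q.D_def h2_def by simp_all
  obtain x0 x2 x3 where x: "x0 \<in> \<rat>" "x2 \<in> \<rat>" "x3 \<in> \<rat>"
    "algebraic_int (x0 + ?p + x2 * ?Q + x3 * ?R)" "\<bar>x2 * ?Q\<bar> < ?p"
    using dp unfolding dominant_def by blast
  obtain y0 y1 y3 where y: "y0 \<in> \<rat>" "y1 \<in> \<rat>" "y3 \<in> \<rat>"
    "algebraic_int (y0 + ?q + y1 * ?P + y3 * ?R)"
    using dq unfolding dominant_def by blast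
  have x4: "algebraic_int (x0 + h1 * ?P + x2 * ?Q + x3 * ?R)" using x(4) unfolding h1 .
  obtain m n :: int where mn: "x2 * ?Q = of_int m * ?q" "x3 * ?R = of_int n * ?r"
    using integer_components[OF x(1) h1(2) x(2,3) x4] by blast
  have y4: "algebraic_int (y0 + y1 * ?P + h2 * ?Q + y3 * ?R)"
    using y(4) unfolding h2 by (simp only: add.assoc add.left_commute)
  obtain m' n' :: int where mn': "y1 * ?P = of_int m' * ?p" "y3 * ?R = of_int n' * ?r"
    using integer_components[OF y(1,2) h2(2) y(3) y4] by blast
  \<comment> \<open>A nonzero multiple of \<open>?q\<close> cannot be smaller in absolute value than
    \<open>?p\<close>, which is at most \<open>?q\<close>.\<close>
  have m0: "m = 0"
  proof (rule ccontr)
    assume "m \<noteq> 0"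
    hence "\<bar>real_of_int m\<bar> \<ge> 1" by linarith
    hence "1 * ?q \<le> \<bar>real_of_int m\<bar> * ?q" by (rule mult_right_mono) simp
    also have "\<dots> = \<bar>x2 * ?Q\<bar>" unfolding mn by (simp add: abs_mult)
    also have "\<dots> < ?p" by (rule x)
    also have "\<dots> \<le> ?q" using le by simp
    finally show False by simp
  qed
  have ix: "algebraic_int (x0 + ?p + of_int n * ?r)" using x(4) unfolding mn m0 by simp
  have iy: "algebraic_int (y0 + ?q + of_int m' * ?p + of_int n' * ?r)" using y(4) unfolding mn' .
  have "algebraic_int (y0 + ?q + of_int m' * ?p + of_int n' * ?r - of_int m' * (x0 + ?p + of_int n * ?r))"
    by (intro algebraic_int_diff iy algebraic_int_mult ix) simp
  also have "y0 + ?q + of_int m' * ?p + of_int n' * ?r - of_int m' * (x0 + ?p + of_int n * ?r)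
    = (y0 - of_int m' * x0) + ?q + of_int (n' - m' * n) * ?r"
    by (simp add: algebra_simps)
  finally have iy': "algebraic_int ((y0 - of_int m' * x0) + ?q + of_int (n' - m' * n) * ?r)" .
  interpret S: biquadratic q p r a c b by (rule biquadratic_swap12[OF biquadratic_axioms])
  have y0': "y0 - of_int m' * x0 \<in> \<rat>" using x y by simp
  \<comment> \<open>In the second use \<open>p\<close> and \<open>q\<close> are exchanged, so
    \<open>c\<close> replaces \<open>b\<close>; each use supplies the congruence that the other
    needs for its parity claim.\<close>
  note op = odd_component[OF x(1) ix] and oq = S.odd_component[OF y0' iy']
  have "even b" using op(2) oq(1) by blast
  moreover have "even c" using oq(2) op(1) by blast
  ultimately show False using cop(3) by (meson coprime_common_divisor_nat dvd_refl coprime_def odd_one)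
qed

lemma not_both_dominant:
  assumes "dominant p q r" "dominant q p r"
  shows False
proof (cases "disc p \<le> disc q")
  case True
  thus ?thesis using assms by (intro not_both_dominant_aux)
next
  case False
  interpret S: biquadratic q p r a c b by (rule biquadratic_swap12[OF biquadratic_axioms])
  show ?thesis using False assms by (intro S.not_both_dominant_aux) simp_all
qed

text \<open>An irrational element without rational part generates \<open>F\<close> and satisfies
  \<open>v * v = s + t * v\<close>. Comparing coefficients leaves it only one nonzero
  component.\<close>

lemma quadratic_subfield_cases:
  assumes F: "subfield F real_ring" "F \<subseteq> span4 p q r" and dim: "ring.dimension real_ring 2 \<rat> F"
  shows "F = P.F \<or> F = Q.F \<or> F = R.F"
proof -
  let ?P = "sqrt (real p)" and ?Q = "sqrt (real q)" and ?R = "sqrt (real r)"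
  note S = subfield_realD[OF F(1)]
  have ratF: "x \<in> F" if "x \<in> \<rat>" for x using S(9) that by blast
  obtain u where u: "u \<in> F" "u \<notin> \<rat>" by (rule dimension_two_irrational[OF dim])
  obtain x0 x1 x2 x3 where x: "x0 \<in> \<rat>" "x1 \<in> \<rat>" "x2 \<in> \<rat>" "x3 \<in> \<rat>"
    "u = x0 + x1 * ?P + x2 * ?Q + x3 * ?R"
    using u(1) F(2) by (meson span4E subsetD)
  define v where "v = u - x0"
  have v: "v = x1 * ?P + x2 * ?Q + x3 * ?R" by (simp add: v_def x)
  have vF: "v \<in> F" using u(1) ratF[OF x(1)] by (simp add: v_def S)
  have vrat: "v \<notin> \<rat>"
  proof
    assume "v \<in> \<rat>"
    hence "v + x0 \<in> \<rat>" using x(1) by (rule Rats_add)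
    thus False using u(2) by (simp add: v_def)
  qed
  have eq: "F = adjoin \<rat> v" by (rule dimension_two_eq_adjoin[OF F(1) dim vF vrat])
  have "v * v \<in> adjoin \<rat> v" using S(6)[OF vF vF] eq by simp
  then obtain s t where st: "s \<in> \<rat>" "t \<in> \<rat>" "v * v = s + t * v" by (rule adjoinE)
  have exp: "(x1 * P' + x2 * Q' + x3 * R') * (x1 * P' + x2 * Q' + x3 * R')
      = x1 * x1 * (P' * P') + x2 * x2 * (Q' * Q') + x3 * x3 * (R' * R')
        + 2 * x2 * x3 * (Q' * R') + 2 * x1 * x3 * (P' * R') + 2 * x1 * x2 * (P' * Q')" for P' Q' R'
    by (simp add: algebra_simps)
  have sq: "sqrt (real d) * sqrt (real d) = real d" for d by simp
  have vv: "v * v = x1 * x1 * real p + x2 * x2 * real q + x3 * x3 * real r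
      + 2 * x2 * x3 * (real c * ?P) + 2 * x1 * x3 * (real b * ?Q) + 2 * x1 * x2 * (real a * ?R)"
    using exp[of ?P ?Q ?R] unfolding sqrt_mult sq v .
  define k0 where "k0 = x1 * x1 * real p + x2 * x2 * real q + x3 * x3 * real r - s"
  have "k0 + (2 * x2 * x3 * c - t * x1) * ?P + (2 * x1 * x3 * b - t * x2) * ?Q
      + (2 * x1 * x2 * a - t * x3) * ?R = v * v - (s + t * v)"
    unfolding vv k0_def unfolding v by (simp add: algebra_simps)
  also have "\<dots> = 0" using st(3) by simp
  finally have z: "k0 + (2 * x2 * x3 * c - t * x1) * ?P + (2 * x1 * x3 * b - t * x2) * ?Q
      + (2 * x1 * x2 * a - t * x3) * ?R = 0" .
  have rats: "k0 \<in> \<rat>" "2 * x2 * x3 * c - t * x1 \<in> \<rat>" "2 * x1 * x3 * b - t * x2 \<in> \<rat>"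
    "2 * x1 * x2 * a - t * x3 \<in> \<rat>"
    using x st by (simp_all add: k0_def)
  note ind = independent[OF rats z]
  have e: "2 * x2 * x3 * c = t * x1" "2 * x1 * x3 * b = t * x2" "2 * x1 * x2 * a = t * x3"
    using ind by simp_all
  have abc: "a > 0" "b > 0" "c > 0" using sqf by (metis neq0_conv not_squarefree_0)+
  have two: False if nz: "x1 \<noteq> 0" "x2 \<noteq> 0"
  proof -
    have "t * x3 \<noteq> 0" using e(3) nz abc by auto
    hence x3: "x3 \<noteq> 0" by simp
    \<comment> \<open>Multiplying two of the coefficient equations cancels \<open>x1 * x2\<close>
      and exhibits \<open>sqrt r\<close> as a rational number.\<close>
    have "(2 * x2 * x3 * c) * (2 * x1 * x3 * b) = (t * x1) * (t * x2)" by (simp only: e)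
    hence "(x1 * x2) * (4 * x3 * x3 * real r) = (x1 * x2) * (t * t)" by (simp add: r algebra_simps)
    hence "4 * x3 * x3 * real r = t * t" using nz by simp
    hence "t * t = (2 * x3) * (2 * x3) * real r" by (simp add: mult.assoc)
    hence "t\<^sup>2 = (2 * x3 * ?R)\<^sup>2" by (simp add: power2_eq_square algebra_simps)
    hence "t = 2 * x3 * ?R \<or> t = - (2 * x3 * ?R)" by (simp only: power2_eq_iff)
    hence "?R = t / (2 * x3) \<or> ?R = - (t / (2 * x3))" using x3 by (auto simp: field_simps)
    moreover have "t / (2 * x3) \<in> \<rat>" using st x by simp
    ultimately show False using R.sqrt_irrational by auto
  qed
  have adj: "F = adjoin \<rat> w" if w: "v = y * w" "y \<in> \<rat>" "w \<notin> \<rat>" for y w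
  proof (rule dimension_two_eq_adjoin[OF F(1) dim _ w(3)])
    have y0: "y \<noteq> 0" using w vrat by auto
    hence "w = v / y" using w by simp
    thus "w \<in> F" using vF ratF[OF w(2)] by (simp add: S)
  qed
  have z12: "x1 = 0 \<or> x2 = 0" using two by blast
  have z: "(x1 = 0 \<and> x2 = 0) \<or> (x1 = 0 \<and> x3 = 0) \<or> (x2 = 0 \<and> x3 = 0)"
    using z12 e abc by auto
  thus ?thesis
  proof (elim disjE conjE)
    assume "x1 = 0" "x2 = 0"
    hence "F = adjoin \<rat> ?R" by (intro adj[OF _ x(4) R.sqrt_irrational]) (simp add: v)
    thus ?thesis by (simp add: R.F_def)
  next
    assume "x1 = 0" "x3 = 0"
    hence "F = adjoin \<rat> ?Q" by (intro adj[OF _ x(3) Q.sqrt_irrational]) (simp add: v)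
    thus ?thesis by (simp add: Q.F_def)
  next
    assume "x2 = 0" "x3 = 0"
    hence "F = adjoin \<rat> ?P" by (intro adj[OF _ x(2) P.sqrt_irrational]) (simp add: v)
    thus ?thesis by (simp add: P.F_def)
  qed
qed

end

section \<open>Decompositions of indecomposables in the biquadratic field\<close>

lemma totally_positive_integers_mono:
  assumes "E \<subseteq> F"
  shows "totally_positive_integers E \<subseteq> totally_positive_integers F"
  using assms real_embeddings_mono[OF assms]
  by (auto simp: totally_positive_integers_def ring_of_integers_def)

context biquadratic
begin

text \<open>An inclusion of \<open>K\<close> in the span suffices: embeddings of the span are
  embeddings of \<open>K\<close>, so the four sign patterns apply.\<close>

lemma totally_positive_conjugates:
  assumes K: "K \<subseteq> span4 p q r" and \<beta>: "\<beta> \<in> totally_positive_integers K"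
  obtains x0 x1 x2 x3 where "x0 \<in> \<rat>" "x1 \<in> \<rat>" "x2 \<in> \<rat>" "x3 \<in> \<rat>"
    "\<beta> = x0 + x1 * sqrt (real p) + x2 * sqrt (real q) + x3 * sqrt (real r)"
    "x0 + x1 * sqrt (real p) + x2 * sqrt (real q) + x3 * sqrt (real r) > 0"
    "x0 + x1 * sqrt (real p) - x2 * sqrt (real q) - x3 * sqrt (real r) > 0"
    "x0 - x1 * sqrt (real p) + x2 * sqrt (real q) - x3 * sqrt (real r) > 0"
    "x0 - x1 * sqrt (real p) - x2 * sqrt (real q) + x3 * sqrt (real r) > 0"
proof -
  have "\<beta> \<in> span4 p q r" using K \<beta> by (auto simp: totally_positive_integers_def ring_of_integers_def)
  then obtain x0 x1 x2 x3 where x: "x0 \<in> \<rat>" "x1 \<in> \<rat>" "x2 \<in> \<rat>" "x3 \<in> \<rat>"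
    "\<beta> = x0 + x1 * sqrt (real p) + x2 * sqrt (real q) + x3 * sqrt (real r)"
    by (rule span4E)
  let ?x = "x0 + x1 * sqrt (real p) + x2 * sqrt (real q) + x3 * sqrt (real r)"
  have pos: "\<sigma> ?x > 0" if "\<sigma> \<in> real_embeddings (span4 p q r)" for \<sigma>
    using \<beta> real_embeddings_mono[OF K] that unfolding x(5)
    by (auto simp: totally_positive_integers_def)
  obtain \<sigma>1 \<sigma>2 \<sigma>3 where \<sigma>: "{\<sigma>1, \<sigma>2, \<sigma>3} \<subseteq> real_embeddings (span4 p q r)"
    "\<sigma>1 ?x = x0 + x1 * sqrt (real p) - x2 * sqrt (real q) - x3 * sqrt (real r)"
    "\<sigma>2 ?x = x0 - x1 * sqrt (real p) + x2 * sqrt (real q) - x3 * sqrt (real r)"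
    "\<sigma>3 ?x = x0 - x1 * sqrt (real p) - x2 * sqrt (real q) + x3 * sqrt (real r)"
    by (rule conjugates[OF x(1-4)])
  have "\<sigma>1 ?x > 0" "\<sigma>2 ?x > 0" "\<sigma>3 ?x > 0" using pos \<sigma>(1) by simp_all
  moreover have "?x > 0" using pos[OF real_embeddings_id] .
  ultimately show ?thesis by (intro that[OF x]) (simp_all only: \<sigma>)
qed

text \<open>The trace to the field of \<open>sqrt p\<close> is twice the part without
  \<open>sqrt q\<close> and \<open>sqrt r\<close>, and it is an integer of that field.\<close>

lemma trace_coefficients:
  assumes x: "x0 \<in> \<rat>" "x1 \<in> \<rat>" "x2 \<in> \<rat>" "x3 \<in> \<rat>"
    and int: "algebraic_int (x0 + x1 * sqrt (real p) + x2 * sqrt (real q) + x3 * sqrt (real r))"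
  obtains j k :: int where "2 * (x0 + x1 * sqrt (real p)) = of_int j + of_int k * P.\<omega>"
    "2 * (x0 - x1 * sqrt (real p)) = of_int j + of_int k * P.\<omega>'"
proof -
  have "algebraic_int (2 * x0 + (2 * x1) * sqrt (real p))"
    using algebraic_int_add[OF int algebraic_int_conjugates(1)[OF x int]]
    by (simp add: algebra_simps)
  moreover have "2 * x0 \<in> \<rat>" "2 * x1 \<in> \<rat>" using x by simp_all
  ultimately obtain j k :: int where jk: "2 * x0 + 2 * x1 * sqrt (real p) = of_int j + of_int k * P.\<omega>"
    "2 * x0 = of_int j + of_int k * P.D / 2" "2 * x1 * sqrt (real p) = of_int k * sqrt P.D / 2"
    by (metis P.algebraic_int_\<omega>_coeffs)
  have "2 * x0 - 2 * x1 * sqrt (real p) = of_int j + of_int k * P.\<omega>'"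
    unfolding jk(2,3) P.\<omega>'_def by (simp add: right_diff_distrib diff_divide_distrib)
  thus ?thesis using jk(1) by (intro that[of j k]) (simp_all add: distrib_left right_diff_distrib mult.assoc)
qed

text \<open>
  The witness is \<open>\<beta> * \<eta>'\<close>, where \<open>\<alpha> = \<beta> + \<gamma>\<close> and \<open>\<eta>\<close> completes \<open>\<alpha>\<close> to a basis as above; its
  conjugates have the sign pattern \<open>+, +, -, -\<close>.
\<close>

lemma dominant_if_decomposable:
  assumes K: "P.F \<subseteq> K" "K \<subseteq> span4 p q r"
    and \<alpha>: "indecomposable P.F \<alpha>" and dec: "\<not> indecomposable K \<alpha>"
  shows "dominant p q r"
proof -
  let ?P = "sqrt (real p)" and ?Q = "sqrt (real q)" and ?R = "sqrt (real r)"
  have "\<alpha> \<in> totally_positive_integers K"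
    using \<alpha> totally_positive_integers_mono[OF K(1)] by (auto simp: indecomposable_def)
  then obtain \<beta> \<gamma> where \<beta>\<gamma>: "\<beta> \<in> totally_positive_integers K" "\<gamma> \<in> totally_positive_integers K"
    "\<alpha> = \<beta> + \<gamma>"
    using dec by (auto simp: indecomposable_def)
  have int: "algebraic_int \<beta>" "algebraic_int \<gamma>"
    using \<beta>\<gamma> by (simp_all add: totally_positive_integers_def ring_of_integers_def)
  obtain x0 x1 x2 x3 where x: "x0 \<in> \<rat>" "x1 \<in> \<rat>" "x2 \<in> \<rat>" "x3 \<in> \<rat>"
    and \<beta>: "\<beta> = x0 + x1 * ?P + x2 * ?Q + x3 * ?R"
    and xpos: "x0 + x1 * ?P + x2 * ?Q + x3 * ?R > 0" "x0 + x1 * ?P - x2 * ?Q - x3 * ?R > 0"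
      "x0 - x1 * ?P + x2 * ?Q - x3 * ?R > 0" "x0 - x1 * ?P - x2 * ?Q + x3 * ?R > 0"
    by (rule totally_positive_conjugates[OF K(2) \<beta>\<gamma>(1)])
  obtain y0 y1 y2 y3 where y: "y0 \<in> \<rat>" "y1 \<in> \<rat>" "y2 \<in> \<rat>" "y3 \<in> \<rat>"
    and \<gamma>: "\<gamma> = y0 + y1 * ?P + y2 * ?Q + y3 * ?R"
    and ypos: "y0 + y1 * ?P + y2 * ?Q + y3 * ?R > 0" "y0 + y1 * ?P - y2 * ?Q - y3 * ?R > 0"
      "y0 - y1 * ?P + y2 * ?Q - y3 * ?R > 0" "y0 - y1 * ?P - y2 * ?Q + y3 * ?R > 0"
    by (rule totally_positive_conjugates[OF K(2) \<beta>\<gamma>(2)])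
  obtain a' b' m n :: int where ab: "\<alpha> = of_int a' + of_int b' * P.\<omega>"
    and \<eta>: "of_int m + of_int n * P.\<omega> < 0" "of_int m + of_int n * P.\<omega>' > 0"
    and det: "b' * m - a' * n = 1"
    by (rule P.indecomposable_basis[OF \<alpha>])
  obtain j k :: int where jk: "2 * (x0 + x1 * ?P) = of_int j + of_int k * P.\<omega>"
    "2 * (x0 - x1 * ?P) = of_int j + of_int k * P.\<omega>'"
    by (rule trace_coefficients[OF x]) (use int(1) \<beta> in auto)
  obtain j' k' :: int where jk': "2 * (y0 + y1 * ?P) = of_int j' + of_int k' * P.\<omega>"
    "2 * (y0 - y1 * ?P) = of_int j' + of_int k' * P.\<omega>'"
    by (rule trace_coefficients[OF y]) (use int(2) \<gamma> in auto)
  obtain u v where uv: "u \<in> \<rat>" "v \<in> \<rat>" "\<alpha> = u + v * ?P"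
    using P.\<omega>_combination_in[of a' b'] unfolding ab[symmetric] P.F_def by (rule adjoinE)
  \<comment> \<open>Since \<open>\<alpha>\<close> has no \<open>sqrt q\<close>- and
    \<open>sqrt r\<close>-components, independence lets \<open>\<alpha> = \<beta> + \<gamma>\<close>
    be compared within the field of \<open>sqrt p\<close>.\<close>
  have "(x0 + y0 - u) + (x1 + y1 - v) * ?P + (x2 + y2) * ?Q + (x3 + y3) * ?R = 0"
    using \<beta>\<gamma>(3) unfolding \<beta> \<gamma> uv(3) by (simp add: algebra_simps)
  note ind = independent[OF _ _ _ _ this]
  have "x0 + y0 - u = 0" "x1 + y1 - v = 0" using x y uv by (intro ind; simp)+
  hence u: "u = x0 + y0" and v: "v = x1 + y1" by simp_all
  have "\<alpha> = (x0 + x1 * ?P) + (y0 + y1 * ?P)" unfolding uv(3) u v by (simp add: algebra_simps)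
  hence "2 * \<alpha> = (of_int j + of_int k * P.\<omega>) + (of_int j' + of_int k' * P.\<omega>)" using jk(1) jk'(1) by simp
  hence "of_int (2 * a' - j - j') + of_int (2 * b' - k - k') * P.\<omega> = 0"
    unfolding ab by (simp add: algebra_simps)
  hence "2 * a' - j - j' = 0 \<and> 2 * b' - k - k' = 0" by (intro P.\<omega>_independent disjI1)
  hence sums: "j' = 2 * a' - j" "k' = 2 * b' - k" by simp_all
  \<comment> \<open>In this proof \<open>D\<close> is the square root of the discriminant.\<close>
  define D where "D = sqrt P.D"
  have D: "D > 0" using P.D_pos by (simp add: D_def)
  define \<eta> \<eta>' where "\<eta> = of_int m + of_int n * P.\<omega>" and "\<eta>' = of_int m + of_int n * P.\<omega>'"
  have \<eta>s: "\<eta> < 0" "\<eta>' > 0" using \<eta> by (simp_all add: \<eta>_def \<eta>'_def)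
  have T: "(of_int s + of_int t * P.\<omega>) * \<eta>' - (of_int s + of_int t * P.\<omega>') * \<eta> = of_int (t * m - s * n) * D"
    for s t
  proof -
    have "(of_int s + of_int t * P.\<omega>) * \<eta>' - (of_int s + of_int t * P.\<omega>') * \<eta>
        = of_int (t * m - s * n) * (P.\<omega> - P.\<omega>')"
      by (simp add: \<eta>_def \<eta>'_def algebra_simps)
    thus ?thesis unfolding P.\<omega>_diff D_def .
  qed
  have Tpos: "t * m - s * n > 0" if "of_int s + of_int t * P.\<omega> > 0" "of_int s + of_int t * P.\<omega>' > 0" for s t
  proof -
    have "(of_int s + of_int t * P.\<omega>) * \<eta>' > 0" "(of_int s + of_int t * P.\<omega>') * \<eta> < 0"
      using that \<eta>s by (simp_all add: mult_pos_neg)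
    hence "of_int (t * m - s * n) * D > 0" unfolding T[symmetric] by linarith
    thus ?thesis using D by (simp only: zero_less_mult_iff of_int_0_less_iff) linarith
  qed
  have "x0 + x1 * ?P > 0" "x0 - x1 * ?P > 0" using xpos by linarith+
  hence 1: "k * m - j * n > 0" by (intro Tpos) (simp_all only: jk[symmetric], simp_all)
  have "y0 + y1 * ?P > 0" "y0 - y1 * ?P > 0" using ypos by linarith+
  hence 2: "k' * m - j' * n > 0" by (intro Tpos) (simp_all only: jk'[symmetric], simp_all)
  have "(k * m - j * n) + (k' * m - j' * n) = 2 * (b' * m - a' * n)"
    unfolding sums by (simp add: algebra_simps)
  hence sum2: "(k * m - j * n) + (k' * m - j' * n) = 2" unfolding det by simp
  \<comment> \<open>Two positive integers with sum 2 are both 1; this fixes the functional on the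
    trace of \<open>\<beta>\<close>.\<close>
  have "s = 1" if "s + t = 2" "s > 0" "t > 0" for s t :: int using that by linarith
  hence kj: "k * m - j * n = 1" using sum2 1 2 by blast
  have main: "(x0 + x1 * ?P) * \<eta>' - (x0 - x1 * ?P) * \<eta> = D / 2"
  proof -
    have "2 * (x0 + x1 * ?P) * \<eta>' - 2 * (x0 - x1 * ?P) * \<eta> = D"
      using T[of j k] unfolding jk[symmetric] kj by simp
    thus ?thesis by (simp only: mult.assoc)
  qed
  obtain h where h: "h \<in> \<rat>" "P.\<omega> = P.D / 2 + h * ?P" "P.\<omega>' = P.D / 2 - h * ?P"
    by (rule P.\<omega>_expand)
  define M N where "M = of_int m + of_int n * (P.D / 2)" and "N = of_int n * h"
  have MN: "M \<in> \<rat>" "N \<in> \<rat>" using h(1) by (simp_all add: M_def N_def P.D_def)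
  have \<eta>MN: "\<eta> = M + N * ?P" "\<eta>' = M - N * ?P"
    unfolding \<eta>_def \<eta>'_def h M_def N_def by (simp_all add: algebra_simps)
  \<comment> \<open>These are the components of \<open>\<beta> * \<eta>'\<close>; the remaining one,
    at \<open>sqrt p\<close>, is given by \<open>X1\<close> and comes from
    \<open>main\<close>.\<close>
  define X0 X2 X3 where "X0 = x0 * M - N * x1 * real p" and "X2 = x2 * M - x3 * N * real b"
    and "X3 = x3 * M - x2 * N * real a"
  have rat: "X0 \<in> \<rat>" "X2 \<in> \<rat>" "X3 \<in> \<rat>" using x MN by (simp_all add: X0_def X2_def X3_def)
  have pp: "?P * ?P = real p" by simp
  have X1: "(x1 * M - x0 * N) * ?P = D / 4"
    using main unfolding \<eta>MN by (simp add: algebra_simps)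
  have expand: "(x0 + e1 * (x1 * P') + e2 * (x2 * Q') + e1 * e2 * (x3 * R')) * (M - e1 * (N * P'))
    = (x0 * M - e1 * e1 * (N * x1 * (P' * P'))) + e1 * ((x1 * M - x0 * N) * P')
      + e2 * (x2 * M * Q' - e1 * e1 * (x3 * N * (P' * R'))) + e1 * e2 * (x3 * M * R' - x2 * N * (P' * Q'))"
    for e1 e2 P' Q' R'
    by (simp add: algebra_simps)
  have prod: "(x0 + e1 * (x1 * ?P) + e2 * (x2 * ?Q) + e1 * e2 * (x3 * ?R)) * (M - e1 * (N * ?P))
    = X0 + e1 * (D / 4) + e2 * (X2 * ?Q) + e1 * e2 * (X3 * ?R)" if "e1 * e1 = 1" for e1 e2
    unfolding expand that pp sqrt_mult X1 X0_def X2_def X3_def by (simp add: algebra_simps)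
  have w1: "(x0 + x1 * ?P + x2 * ?Q + x3 * ?R) * \<eta>' = X0 + D / 4 + X2 * ?Q + X3 * ?R"
    using prod[of 1 1] by (simp add: \<eta>MN)
  have w2: "(x0 + x1 * ?P - x2 * ?Q - x3 * ?R) * \<eta>' = X0 + D / 4 - X2 * ?Q - X3 * ?R"
    using prod[of 1 "-1"] by (simp add: \<eta>MN)
  have w3: "(x0 - x1 * ?P + x2 * ?Q - x3 * ?R) * \<eta> = X0 - D / 4 + X2 * ?Q - X3 * ?R"
    using prod[of "-1" 1] by (simp add: \<eta>MN)
  have w4: "(x0 - x1 * ?P - x2 * ?Q + x3 * ?R) * \<eta> = X0 - D / 4 - X2 * ?Q + X3 * ?R"
    using prod[of "-1" "-1"] by (simp add: \<eta>MN)
  \<comment> \<open>The conjugates of \<open>\<beta>\<close> are positive, so the signs are those of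
    \<open>\<eta>'\<close> and \<open>\<eta>\<close>. Subtracting a negative conjugate from a
    positive one eliminates \<open>X0\<close> and one further component.\<close>
  have "X0 + D / 4 + X2 * ?Q + X3 * ?R > 0" "X0 + D / 4 - X2 * ?Q - X3 * ?R > 0"
    "X0 - D / 4 + X2 * ?Q - X3 * ?R < 0" "X0 - D / 4 - X2 * ?Q + X3 * ?R < 0"
    unfolding w1[symmetric] w2[symmetric] w3[symmetric] w4[symmetric]
    by (rule mult_pos_pos[OF xpos(1) \<eta>s(2)], rule mult_pos_pos[OF xpos(2) \<eta>s(2)],
        rule mult_pos_neg[OF xpos(3) \<eta>s(1)], rule mult_pos_neg[OF xpos(4) \<eta>s(1)])
  hence bound: "\<bar>X2 * ?Q\<bar> < D / 4" "\<bar>X3 * ?R\<bar> < D / 4" by linarith+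
  \<comment> \<open>Conjugation sends \<open>\<omega>\<close> to \<open>D - \<omega>\<close>, with
    \<open>D\<close> the discriminant itself here, so \<open>\<eta>'\<close> is again an integer
    combination.\<close>
  have "\<eta>' = of_int (m + n * int (disc p)) + of_int (- n) * P.\<omega>"
    by (simp add: \<eta>'_def P.\<omega>_def P.\<omega>'_def P.D_def field_simps)
  hence "algebraic_int \<eta>'" using P.algebraic_int_\<omega> by (simp only:)
  hence "algebraic_int (\<beta> * \<eta>')" by (rule algebraic_int_mult[OF int(1)])
  hence "algebraic_int (X0 + D / 4 + X2 * ?Q + X3 * ?R)" unfolding \<beta> w1 .
  thus ?thesis using rat bound unfolding dominant_def D_def P.D_def by blast
qed

end

section \<open>Reduction of a real biquadratic field to squarefree radicands\<close>

lemma real_biquadratic_fieldE: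
  assumes "real_biquadratic_field K"
  obtains p q r a b c where "biquadratic p q r a b c" "K \<subseteq> span4 p q r"
proof -
  obtain p0 q0 :: nat where K: "p0 > 0" "q0 > 0" "K = generate_field real_ring {sqrt (real p0), sqrt (real q0)}"
    and dim: "ring.dimension real_ring 4 \<rat> K"
    using assms unfolding real_biquadratic_field_def by blast
  interpret R: field real_ring by (rule field_real_ring)
  have K_subset: "K \<subseteq> E" if "subfield E real_ring" "sqrt (real p0) \<in> E" "sqrt (real q0) \<in> E" for E
    unfolding K(3) by (rule R.generate_field_min_subfield1) (use that in auto)
  \<comment> \<open>Passing to squarefree parts changes the square roots only by natural factors, so
    inclusions of \<open>K\<close> can be tested on the new roots.\<close>
  define p q where "p = squarefree_part p0" and "q = squarefree_part q0"
  have sqf: "squarefree p" "squarefree q" by (auto simp: p_def q_def)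
  have sqrt_part: "sqrt (real n) = real (square_part n) * sqrt (real (squarefree_part n))" for n :: nat
  proof -
    have "real n = real (square_part n) ^ 2 * real (squarefree_part n)"
      using squarefree_decompose[of n] by (metis mult.commute of_nat_mult of_nat_power)
    thus ?thesis by (simp add: real_sqrt_mult)
  qed
  \<comment> \<open>The degenerate cases \<open>p = 1\<close>, \<open>q = 1\<close> and
    \<open>p = q\<close> all put \<open>K\<close> into one
    \<open>adjoin \<rat> (sqrt (real d))\<close>, against dimension 4.\<close>
  have not_quadratic: False if d: "p = 1 \<or> p = d" "q = 1 \<or> q = d" for d
  proof -
    have F: "subfield (adjoin \<rat> (sqrt (real d))) real_ring"
      by (rule subfield_adjoin[OF subfield_Rats]) simp
    note S = subfield_realD[OF F]
    have sqrt_in: "sqrt (real e) \<in> adjoin \<rat> (sqrt (real d))" if "e = 1 \<or> e = d" for e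
      using that S(2) subset_adjoin(2)[OF subfield_Rats] by auto
    have nat_in: "real n \<in> adjoin \<rat> (sqrt (real d))" for n using S(9) by auto
    have "sqrt (real p0) \<in> adjoin \<rat> (sqrt (real d))"
      unfolding sqrt_part[of p0] p_def[symmetric] by (rule S(6)[OF nat_in sqrt_in[OF d(1)]])
    moreover have "sqrt (real q0) \<in> adjoin \<rat> (sqrt (real d))"
      unfolding sqrt_part[of q0] q_def[symmetric] by (rule S(6)[OF nat_in sqrt_in[OF d(2)]])
    ultimately have "K \<subseteq> adjoin \<rat> (sqrt (real d))" by (rule K_subset[OF F])
    from dimension_quadratic_le[OF dim this] show False by simp
  qed
  have p1: "p \<noteq> 1" using not_quadratic[of q] by auto
  have q1: "q \<noteq> 1" using not_quadratic[of p] by auto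
  have pq: "p \<noteq> q" using not_quadratic[of p] by auto
  define a where "a = gcd p q"
  have pos: "p > 0" "q > 0" using sqf by (auto intro: Nat.gr0I)
  obtain b where b: "p = a * b" unfolding a_def by (meson dvdE gcd_dvd1)
  obtain c where c: "q = a * c" unfolding a_def by (meson dvdE gcd_dvd2)
  have coprime_of_squarefree: "coprime u v" if "squarefree (u * v)" for u v :: nat
  proof (rule coprimeI)
    fix g assume "g dvd u" "g dvd v"
    hence "g ^ 2 dvd u * v" by (simp add: power2_eq_square mult_dvd_mono)
    thus "is_unit g" using squarefreeD[OF that] by blast
  qed
  have "a > 0" using pos by (simp add: a_def)
  moreover have "a * gcd b c = a"
    using gcd_mult_distrib_nat[of a b c] unfolding b[symmetric] c[symmetric] a_def[symmetric] .
  ultimately have bc: "coprime b c" by (simp add: coprime_iff_gcd_eq_1)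
  have "b * c \<noteq> 1"
  proof
    assume "b * c = 1"
    hence "b = 1" "c = 1" by simp_all
    thus False using pq b c by simp
  qed
  have bq: "biquadratic p q (b * c) a b c"
  proof
    show "squarefree a" "squarefree b" using squarefree_multD[of a b] sqf(1) unfolding b by auto
    show "squarefree c" using squarefree_multD[of a c] sqf(2) unfolding c by auto
    show "coprime a b" using coprime_of_squarefree sqf(1) unfolding b by blast
    show "coprime a c" using coprime_of_squarefree sqf(2) unfolding c by blast
  qed (use b c bc p1 q1 \<open>b * c \<noteq> 1\<close> in auto)
  interpret biquadratic p q "b * c" a b c by (rule bq)
  note S = subfield_realD[OF subfield_span4]
  have sqrt_in: "sqrt (real p) \<in> span4 p q (b * c)" "sqrt (real q) \<in> span4 p q (b * c)"
    by (rule span4I[of 0 1 0 0], simp_all) (rule span4I[of 0 0 1 0], simp_all)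
  have nat_in: "real n \<in> span4 p q (b * c)" for n using S(9) by auto
  have "sqrt (real p0) \<in> span4 p q (b * c)"
    unfolding sqrt_part[of p0] p_def[symmetric] by (rule S(6)[OF nat_in sqrt_in(1)])
  moreover have "sqrt (real q0) \<in> span4 p q (b * c)"
    unfolding sqrt_part[of q0] q_def[symmetric] by (rule S(6)[OF nat_in sqrt_in(2)])
  ultimately have "K \<subseteq> span4 p q (b * c)" by (rule K_subset[OF subfield_span4])
  with bq show ?thesis by (rule that)
qed

theorem theorem1p5:
  fixes K :: "real set" and L :: "nat \<Rightarrow> real set"
  assumes "real_biquadratic_field K"
    and "bij_betw L {1, 2, 3} (quadratic_subfields K)"
  shows "card {j \<in> {1, 2, 3}. \<forall>\<alpha>. indecomposable (L j) \<alpha> \<longrightarrow> indecomposable K \<alpha>} \<ge> 2"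
proof -
  obtain p q r a b c where bq: "biquadratic p q r a b c" and K: "K \<subseteq> span4 p q r"
    using assms(1) by (rule real_biquadratic_fieldE)
  \<comment> \<open>\<open>A\<close>, \<open>B\<close> and \<open>C\<close> put each radicand first
    in turn; \<open>A2\<close> and \<open>B2\<close> provide the orders in which the pairs
    \<open>p, r\<close> and \<open>q, r\<close> come first.\<close>
  interpret A: biquadratic p q r a b c by (rule bq)
  interpret A2: biquadratic p r q b a c by (rule biquadratic_swap23[OF bq])
  interpret B: biquadratic q p r a c b by (rule biquadratic_swap12[OF bq])
  interpret B2: biquadratic q r p c a b by (rule biquadratic_swap23[OF biquadratic_swap12[OF bq]])
  interpret C: biquadratic r p q b c a by (rule biquadratic_swap12[OF biquadratic_swap23[OF bq]])
  define good where "good j \<longleftrightarrow> (\<forall>\<alpha>. indecomposable (L j) \<alpha> \<longrightarrow> indecomposable K \<alpha>)" for j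
  have Kq: "K \<subseteq> span4 q p r" using K span4_swap12[of p q r] by simp
  have Kr: "K \<subseteq> span4 r p q" using K span4_swap23[of p q r] span4_swap12[of p r q] by simp
  have classify: "(L j = A.P.F \<and> dominant p q r) \<or> (L j = A.Q.F \<and> dominant q p r) \<or> (L j = A.R.F \<and> dominant r p q)"
    if j: "j \<in> {1, 2, 3}" "\<not> good j" for j
  proof -
    have "L j \<in> quadratic_subfields K" using bij_betwE[OF assms(2)] j(1) by blast
    hence L: "L j \<subseteq> K" "subfield (L j) real_ring" "ring.dimension real_ring 2 \<rat> (L j)"
      by (simp_all add: quadratic_subfields_def)
    obtain \<alpha> where \<alpha>: "indecomposable (L j) \<alpha>" "\<not> indecomposable K \<alpha>"
      using j(2) unfolding good_def by blast
    have "L j = A.P.F \<or> L j = A.Q.F \<or> L j = A.R.F"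
      by (rule A.quadratic_subfield_cases[OF L(2) subset_trans[OF L(1) K] L(3)])
    thus ?thesis
    proof (elim disjE)
      assume F: "L j = A.P.F"
      hence "dominant p q r"
        using A.dominant_if_decomposable[OF _ K, of \<alpha>] L(1) \<alpha> by simp
      thus ?thesis using F by simp
    next
      assume F: "L j = A.Q.F"
      hence "dominant q p r"
        using B.dominant_if_decomposable[OF _ Kq, of \<alpha>] L(1) \<alpha> by simp
      thus ?thesis using F by simp
    next
      assume F: "L j = A.R.F"
      hence "dominant r p q"
        using C.dominant_if_decomposable[OF _ Kr, of \<alpha>] L(1) \<alpha> by simp
      thus ?thesis using F by simp
    qed
  qed
  have excl1: "\<not> (dominant p q r \<and> dominant q p r)" using A.not_both_dominant by blast
  have excl2: "\<not> (dominant p q r \<and> dominant r p q)"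
    unfolding dominant_commute[of p q r] using A2.not_both_dominant by blast
  have excl3: "\<not> (dominant q p r \<and> dominant r p q)"
    unfolding dominant_commute[of q p r] dominant_commute[of r p q] using B2.not_both_dominant by blast
  \<comment> \<open>Two bad indices would yield two dominant radicands unless their subfields agree,
    and then injectivity of \<open>L\<close> identifies them.\<close>
  have unique: "i = j" if ij: "i \<in> {1, 2, 3}" "\<not> good i" "j \<in> {1, 2, 3}" "\<not> good j" for i j
  proof -
    have "L i = L j"
      using classify[OF ij(1,2)] classify[OF ij(3,4)] excl1 excl2 excl3
      by (elim disjE conjE; simp)
    moreover have "inj_on L {1, 2, 3}" using assms(2) by (simp add: bij_betw_def)
    ultimately show ?thesis using ij(1,3) by (intro inj_onD[of L "{1, 2, 3}"])
  qed
  define G where "G = {j \<in> {1, 2, 3}. good j}"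
  have "\<forall>i\<in>{1, 2, 3} - G. \<forall>j\<in>{1, 2, 3} - G. i = j"
  proof (intro ballI)
    fix i j assume "i \<in> {1, 2, 3} - G" "j \<in> {1, 2, 3} - G"
    hence "i \<in> {1, 2, 3}" "\<not> good i" "j \<in> {1, 2, 3}" "\<not> good j" unfolding G_def by blast+
    thus "i = j" by (rule unique)
  qed
  hence le: "card ({1, 2, 3} - G) \<le> Suc 0"
    by (rule card_le_Suc0_iff_eq[THEN iffD2, rotated]) simp
  have sub: "G \<subseteq> {1, 2, 3}" by (auto simp: G_def)
  have "finite G" by (rule finite_subset[OF sub]) simp
  hence "card ({1, 2, 3} - G) = card {1, 2, 3 :: nat} - card G" using sub by (rule card_Diff_subset)
  moreover have "card {1, 2, 3 :: nat} = 3" by simp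
  ultimately have "card G \<ge> 2" using le by linarith
  thus ?thesis unfolding G_def good_def .
qed

end
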